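(* Let $q$ be a prime power, let $G=\mathrm{PGL}_2(q)$, and let $c\in\mathbb{Z}^+\cup\{\infty\}$. Then $G$ has a $2$-minimal $c$-nilpotent cover, and $$\omega_c(G)=\begin{cases} 4 & \text{if } q=2,\\ 7 & \text{if } c>1 \text{ and } q=3,\\ 10 & \text{if } c=1 \text{ and } q=3,\\ q^2+q+1 & \text{if } q\ge 4.\end{cases}$$
   Context: For $c\in\mathbb{Z}^+$, a group is $c$-nilpotent if it is nilpotent of class at most $c$; it is $\infty$-nilpotent if it is nilpotent. A subset $X$ of a group $G$ is non-$c$-nilpotent if for any two distinct $x,y\in X$ the subgroup $\langle x,y\rangle$ is not $c$-nilpotent; $\omega_c(G)$ is the maximum order of a non-$c$-nilpotent subset of $G$. A family $\mathcal{N}$ of $c$-nilpotent subgroups of $G$ is a $c$-nilpotent cover of $G$ if every element of $G$ lies in some member of $\mathcal{N}$; it is $2$-minimal if one can choose for each member $X_i\in\mathcal{N}$ an element $g_i\in X_i$ (a distinguished element) such that $\langle g_i,g_j\rangle$ is not $c$-nilpotent whenever $i\ne j$. The convention $c>1$ includes $c=\infty$. *)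

theory Defs
  imports
    "HOL-Analysis.Analysis"
    "HOL-Algebra.Generated_Groups"
    "HOL-Library.Extended_Nat"
    "HOL-Number_Theory.Prime_Powers"
begin

section \<open>Nilpotent groups\<close>

text \<open>
  The lower central series is indexed from \<open>0\<close>: \<open>lower_central G n\<close> is the term
  usually written \<open>\<gamma>\<close> with index \<open>n + 1\<close>.  Hence \<open>G\<close> has class \<open>n\<close> iff \<open>n\<close> is the least
  index at which the series is trivial.
\<close>

primrec lower_central :: "('a, 'b) monoid_scheme \<Rightarrow> nat \<Rightarrow> 'a set" where
  "lower_central G 0 = carrier G"
| "lower_central G (Suc n) = generate G
     (\<Union>h \<in> lower_central G n. \<Union>g \<in> carrier G.
        {h \<otimes>\<^bsub>G\<^esub> g \<otimes>\<^bsub>G\<^esub> inv\<^bsub>G\<^esub> h \<otimes>\<^bsub>G\<^esub> inv\<^bsub>G\<^esub> g})"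

definition nilpotent_group :: "('a, 'b) monoid_scheme \<Rightarrow> bool" where
  "nilpotent_group G \<longleftrightarrow> group G \<and> (\<exists>n. lower_central G n = {\<one>\<^bsub>G\<^esub>})"

definition nilpotency_class :: "('a, 'b) monoid_scheme \<Rightarrow> nat" where
  "nilpotency_class G = (LEAST n. lower_central G n = {\<one>\<^bsub>G\<^esub>})"

text \<open>The case \<open>c = \<infinity>\<close> is plain nilpotency.\<close>

definition c_nilpotent :: "enat \<Rightarrow> ('a, 'b) monoid_scheme \<Rightarrow> bool" where
  "c_nilpotent c G \<longleftrightarrow> nilpotent_group G \<and> enat (nilpotency_class G) \<le> c"

abbreviation c_nilpotent_in :: "enat \<Rightarrow> ('a, 'b) monoid_scheme \<Rightarrow> 'a set \<Rightarrow> bool" where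
  "c_nilpotent_in c G H \<equiv> c_nilpotent c (G\<lparr>carrier := H\<rparr>)"


section \<open>Non-nilpotent subsets and nilpotent covers\<close>

definition non_c_nilpotent_subset :: "enat \<Rightarrow> ('a, 'b) monoid_scheme \<Rightarrow> 'a set \<Rightarrow> bool" where
  "non_c_nilpotent_subset c G X \<longleftrightarrow> X \<subseteq> carrier G \<and>
     (\<forall>x \<in> X. \<forall>y \<in> X. x \<noteq> y \<longrightarrow> \<not> c_nilpotent_in c G (generate G {x, y}))"

text \<open>Meaningful for finite \<open>G\<close> only: otherwise the maximum need not exist.\<close>

definition omega :: "enat \<Rightarrow> ('a, 'b) monoid_scheme \<Rightarrow> nat" where
  "omega c G = Max {card X |X. finite X \<and> non_c_nilpotent_subset c G X}"

definition c_nilpotent_cover :: "enat \<Rightarrow> ('a, 'b) monoid_scheme \<Rightarrow> 'a set set \<Rightarrow> bool" where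
  "c_nilpotent_cover c G N \<longleftrightarrow>
     (\<forall>H \<in> N. subgroup H G \<and> c_nilpotent_in c G H) \<and>
     (\<forall>g \<in> carrier G. \<exists>H \<in> N. g \<in> H)"

text \<open>\<open>d\<close> chooses the distinguished elements.\<close>

definition two_minimal :: "enat \<Rightarrow> ('a, 'b) monoid_scheme \<Rightarrow> 'a set set \<Rightarrow> bool" where
  "two_minimal c G N \<longleftrightarrow> (\<exists>d. (\<forall>H \<in> N. d H \<in> H) \<and>
     (\<forall>H \<in> N. \<forall>K \<in> N. H \<noteq> K \<longrightarrow> \<not> c_nilpotent_in c G (generate G {d H, d K})))"


section \<open>Projective general linear groups\<close>

definition GL :: "('a::field^'n^'n) monoid" where
  "GL = \<lparr>carrier = {A. invertible A}, mult = (**), one = mat 1\<rparr>"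

definition nonzero_scalars :: "('a::field^'n^'n) set" where
  "nonzero_scalars = {mat k |k. k \<noteq> 0}"

definition PGL :: "('a::field^'n^'n) set monoid" where
  "PGL = GL Mod nonzero_scalars"

end

theory Submission
  imports Defs "HOL-Number_Theory.Residues"
begin

text \<open>
  Let \<open>F\<close> be the field with \<open>q\<close> elements.  A nonscalar matrix \<open>A\<close> lies in exactly one plane of the
  matrix space that contains the scalars, namely the algebra \<open>F[A]\<close>.  These planes are the points of a
  projective plane over \<open>F\<close>, so there are \<open>q\<^sup>2 + q + 1\<close> of them.  The units of each plane form, modulo
  scalars, an abelian subgroup of \<open>G\<close>; these subgroups cover \<open>G\<close> and pairwise meet trivially.
  They are the split tori, the nonsplit tori and the transvection groups, here all called
  tori and treated alike.

  A matrix commutes with \<open>A\<close> modulo scalars only if it commutes with \<open>A\<close>, provided that \<open>A\<close> has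
  nonzero trace or \<open>F\<close> has characteristic two (\<open>projective_commute_imp_commute\<close>).  The centralizer
  of such a regular element is therefore exactly its torus (\<open>centralizer_regular\<close>).  Since a
  nontrivial nilpotent group has a nontrivial centre, regular elements from two different tori never
  generate a nilpotent group, whatever the bound on the class
  (\<open>not_c_nilpotent_if_centralizers_disjoint\<close>).  If every torus contains a regular
  element, the tori are a two-minimal cover for every \<open>c\<close>; and the number of members of a
  two-minimal cover is always the maximal size of a non-nilpotent subset
  (\<open>two_minimal_cover_omega\<close>).  For \<open>q \<ge> 4\<close> this hypothesis holds by counting
  (\<open>regular_planes_large\<close>).

  For \<open>q = 2\<close> three of the seven tori are trivial and the other four remain.  For \<open>q = 3\<close> the
  six split tori have order two and contain no regular element, which leaves seven tori.  If
  \<open>c > 1\<close>, the missing involutions fit into the three dihedral centralizers of the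
  double transpositions in \<open>G\<close>, the symmetric group of degree four, and these have class two;
  they replace the nonsplit tori, and the cover keeps seven members.  If \<open>c = 1\<close>, three Klein
  four-groups have to be added, which gives ten.
\<close>

section \<open>Nilpotency of subgroups\<close>

text \<open>
  A bound on the class only asks that the series has become trivial at some index at most \<open>c\<close>;
  in this form the least such index, which defines the class, never has to be computed.
\<close>

lemma c_nilpotent_iff:
  "c_nilpotent c G \<longleftrightarrow> group G \<and> (\<exists>n. enat n \<le> c \<and> lower_central G n = {\<one>\<^bsub>G\<^esub>})"
proof
  assume "c_nilpotent c G"
  then show "group G \<and> (\<exists>n. enat n \<le> c \<and> lower_central G n = {\<one>\<^bsub>G\<^esub>})"
    unfolding c_nilpotent_def nilpotent_group_def nilpotency_class_def
    by (metis (mono_tags, lifting) LeastI_ex)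
next
  assume r: "group G \<and> (\<exists>n. enat n \<le> c \<and> lower_central G n = {\<one>\<^bsub>G\<^esub>})"
  then obtain n where n: "enat n \<le> c" "lower_central G n = {\<one>\<^bsub>G\<^esub>}" by blast
  have "nilpotency_class G \<le> n"
    unfolding nilpotency_class_def using n(2) by (rule Least_le)
  then have "enat (nilpotency_class G) \<le> c"
    using n(1) by (meson enat_ord_simps(1) order_trans)
  then show "c_nilpotent c G"
    using r n unfolding c_nilpotent_def nilpotent_group_def by blast
qed

context group
begin

text \<open>
  The lower central series of a subgroup, computed with the inverses and generated subgroups
  of the ambient group, so that the series of different subgroups can be compared.
\<close>

lemma lower_central_Suc_in:
  assumes H: "subgroup H G"
  shows "lower_central (G\<lparr>carrier := H\<rparr>) (Suc n) = generate G
     (\<Union>h \<in> lower_central (G\<lparr>carrier := H\<rparr>) n. \<Union>g \<in> H. {h \<otimes> g \<otimes> inv h \<otimes> inv g})"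
    and lower_central_in_subset: "lower_central (G\<lparr>carrier := H\<rparr>) n \<subseteq> H"
proof -
  let ?L = "lower_central (G\<lparr>carrier := H\<rparr>)"
  let ?S = "\<lambda>n. \<Union>h \<in> ?L n. \<Union>g \<in> H. {h \<otimes> g \<otimes> inv h \<otimes> inv g}"
  have step: "?L (Suc n) = generate G (?S n) \<and> ?L (Suc n) \<subseteq> H" if L: "?L n \<subseteq> H" for n
  proof -
    have sub: "?S n \<subseteq> H"
    proof clarsimp
      fix h g assume "h \<in> ?L n" "g \<in> H"
      then have "h \<in> H" "g \<in> H" using L by auto
      then show "h \<otimes> g \<otimes> inv h \<otimes> inv g \<in> H"
        by (simp add: H subgroup.m_closed subgroup.m_inv_closed)
    qed
    have "(\<Union>h \<in> ?L n. \<Union>g \<in> H. {h \<otimes> g \<otimes> inv\<^bsub>G\<lparr>carrier := H\<rparr>\<^esub> h \<otimes> inv\<^bsub>G\<lparr>carrier := H\<rparr>\<^esub> g}) = ?S n"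
      using L H by (intro SUP_cong) (auto simp: subset_eq)
    then have "?L (Suc n) = generate (G\<lparr>carrier := H\<rparr>) (?S n)" by simp
    also have "\<dots> = generate G (?S n)"
      using generate_consistent[OF sub H] by simp
    finally show ?thesis using generate_subgroup_incl[OF sub H] by simp
  qed
  have all: "?L n \<subseteq> H" for n
  proof (induction n)
    case 0 show ?case by simp
  next
    case (Suc n) then show ?case using step by blast
  qed
  show "?L (Suc n) = generate G (?S n)" using step all by blast
  show "?L n \<subseteq> H" by (rule all)
qed

lemma one_in_lower_central:
  assumes "subgroup H G"
  shows "\<one> \<in> lower_central (G\<lparr>carrier := H\<rparr>) n"
proof (cases n)
  case 0 then show ?thesis using subgroup.one_closed[OF assms] by simp
next
  case (Suc m)
  then show ?thesis by (simp only: lower_central_Suc_in[OF assms] generate.one)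
qed

lemma lower_central_mono:
  assumes K: "subgroup K G" and H: "subgroup H G" and KH: "K \<subseteq> H"
  shows "lower_central (G\<lparr>carrier := K\<rparr>) n \<subseteq> lower_central (G\<lparr>carrier := H\<rparr>) n"
proof (induction n)
  case 0 then show ?case using KH by simp
next
  case (Suc n)
  have "(\<Union>h \<in> lower_central (G\<lparr>carrier := K\<rparr>) n. \<Union>g \<in> K. {h \<otimes> g \<otimes> inv h \<otimes> inv g})
     \<subseteq> (\<Union>h \<in> lower_central (G\<lparr>carrier := H\<rparr>) n. \<Union>g \<in> H. {h \<otimes> g \<otimes> inv h \<otimes> inv g})"
    using Suc KH by blast
  then show ?case
    unfolding lower_central_Suc_in[OF K] lower_central_Suc_in[OF H] by (rule mono_generate)
qed

lemma c_nilpotent_in_iff: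
  assumes "subgroup H G"
  shows "c_nilpotent_in c G H \<longleftrightarrow>
    (\<exists>n. enat n \<le> c \<and> lower_central (G\<lparr>carrier := H\<rparr>) n \<subseteq> {\<one>})"
  using subgroup_imp_group[OF assms] one_in_lower_central[OF assms]
  by (auto simp: c_nilpotent_iff)

lemma c_nilpotent_in_mono:
  assumes "subgroup K G" "subgroup H G" "K \<subseteq> H" "c_nilpotent_in c G H"
  shows "c_nilpotent_in c G K"
  using assms lower_central_mono[OF assms(1-3)] c_nilpotent_in_iff by (meson subset_trans)

lemma commutator_eq_one_iff:
  assumes "x \<in> carrier G" "y \<in> carrier G"
  shows "x \<otimes> y \<otimes> inv x \<otimes> inv y = \<one> \<longleftrightarrow> x \<otimes> y = y \<otimes> x"
proof -
  have "x \<otimes> y \<otimes> inv x \<otimes> inv y = (x \<otimes> y) \<otimes> inv (y \<otimes> x)"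
    using assms by (simp add: m_assoc inv_mult_group)
  then show ?thesis
    using assms by (metis inv_equality inv_inv m_closed inv_closed r_inv)
qed

lemma generate_commutators_trivial:
  assumes "A \<subseteq> carrier G" "H \<subseteq> carrier G"
    and "\<And>x y. x \<in> A \<Longrightarrow> y \<in> H \<Longrightarrow> x \<otimes> y = y \<otimes> x"
  shows "generate G (\<Union>h \<in> A. \<Union>g \<in> H. {h \<otimes> g \<otimes> inv h \<otimes> inv g}) \<subseteq> {\<one>}"
proof -
  have "(\<Union>h \<in> A. \<Union>g \<in> H. {h \<otimes> g \<otimes> inv h \<otimes> inv g}) \<subseteq> {\<one>}"
    using assms by (auto simp: commutator_eq_one_iff subset_eq)
  then show ?thesis by (rule generate_subgroup_incl[OF _ triv_subgroup])
qed

lemma c_nilpotent_in_abelian: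
  assumes H: "subgroup H G" and "1 \<le> c"
    and "\<And>x y. x \<in> H \<Longrightarrow> y \<in> H \<Longrightarrow> x \<otimes> y = y \<otimes> x"
  shows "c_nilpotent_in c G H"
proof -
  have "lower_central (G\<lparr>carrier := H\<rparr>) (Suc 0) \<subseteq> {\<one>}"
    unfolding lower_central_Suc_in[OF H]
    using generate_commutators_trivial[of H H] subgroup.subset[OF H] assms(3) by simp
  moreover have "enat (Suc 0) \<le> c" using assms(2) by (simp add: one_enat_def)
  ultimately show ?thesis using c_nilpotent_in_iff[OF H] by blast
qed

definition centralizer :: "'a \<Rightarrow> 'a set" where
  "centralizer x = {y \<in> carrier G. x \<otimes> y = y \<otimes> x}"

lemma subgroup_centralizer:
  assumes "x \<in> carrier G" shows "subgroup (centralizer x) G"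
proof (rule subgroupI)
  show "centralizer x \<subseteq> carrier G" by (auto simp: centralizer_def)
  show "centralizer x \<noteq> {}" using assms by (auto simp: centralizer_def)
next
  fix a assume a: "a \<in> centralizer x"
  then have "a \<in> carrier G" "x \<otimes> a = a \<otimes> x" by (auto simp: centralizer_def)
  then have "x \<otimes> inv a = inv a \<otimes> x"
    using assms by (metis inv_closed inv_solve_left inv_solve_right m_assoc m_closed)
  then show "inv a \<in> centralizer x" using a by (auto simp: centralizer_def)
next
  fix a b assume "a \<in> centralizer x" "b \<in> centralizer x"
  then have a: "a \<in> carrier G" "x \<otimes> a = a \<otimes> x" and b: "b \<in> carrier G" "x \<otimes> b = b \<otimes> x"
    by (auto simp: centralizer_def)
  have "x \<otimes> (a \<otimes> b) = a \<otimes> b \<otimes> x" using a b assms by (metis m_assoc)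
  then show "a \<otimes> b \<in> centralizer x" using a b by (auto simp: centralizer_def)
qed

lemma commute_generateI:
  assumes "x \<in> carrier G" "S \<subseteq> carrier G" "\<And>s. s \<in> S \<Longrightarrow> x \<otimes> s = s \<otimes> x" "y \<in> generate G S"
  shows "x \<otimes> y = y \<otimes> x"
proof -
  have "S \<subseteq> centralizer x" using assms by (auto simp: centralizer_def)
  then have "generate G S \<subseteq> centralizer x"
    using generate_subgroup_incl subgroup_centralizer[OF assms(1)] by blast
  then show ?thesis using assms(4) by (auto simp: centralizer_def)
qed

lemma c_nilpotent_in_generate_commuting:
  assumes "1 \<le> c" "x \<in> carrier G" "y \<in> carrier G" "x \<otimes> y = y \<otimes> x"
  shows "c_nilpotent_in c G (generate G {x, y})"
proof (rule c_nilpotent_in_abelian[OF generate_is_subgroup assms(1)])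
  show "{x, y} \<subseteq> carrier G" using assms by auto
next
  let ?H = "generate G {x, y}"
  have S: "{x, y} \<subseteq> carrier G" using assms by auto
  have *: "a \<otimes> s = s \<otimes> a" if a: "a \<in> ?H" and s: "s \<in> {x, y}" for a s
  proof -
    have "s \<otimes> a = a \<otimes> s"
      by (rule commute_generateI[OF _ S _ a]) (use s assms in auto)
    then show ?thesis by simp
  qed
  fix a b assume "a \<in> ?H" "b \<in> ?H"
  then show "a \<otimes> b = b \<otimes> a"
    using commute_generateI[OF _ S, of a b] * generate_in_carrier[OF S] by blast
qed

text \<open>
  Modulo the central subgroup generated by its squares, \<open>H\<close> has exponent two and is therefore
  abelian.  So all commutators are central, and the series is trivial from index \<open>2\<close> on.
\<close>

lemma class_two_if_squares_central:
  assumes H: "subgroup H G" and "1 < c"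
    and sq: "\<And>x y. x \<in> H \<Longrightarrow> y \<in> H \<Longrightarrow> (x \<otimes> x) \<otimes> y = y \<otimes> (x \<otimes> x)"
  shows "c_nilpotent_in c G H"
proof -
  let ?L = "lower_central (G\<lparr>carrier := H\<rparr>)"
  have HG: "H \<subseteq> carrier G" using subgroup.subset[OF H] .
  note mc = subgroup.m_closed[OF H] and ic = subgroup.m_inv_closed[OF H]
  let ?S = "\<Union>h \<in> H. \<Union>g \<in> H. {h \<otimes> g \<otimes> inv h \<otimes> inv g}"
  \<comment> \<open>The commutator of \<open>h\<close> and \<open>g\<close> is \<open>(h g) (h g)\<close> divided by \<open>g (h h) g = (h h) (g g)\<close>,
    hence a product of squares and their inverses.\<close>
  have comm: "h \<otimes> g \<otimes> inv h \<otimes> inv g \<in> centralizer y"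
    if h: "h \<in> H" and g: "g \<in> H" and y: "y \<in> H" for h g y
  proof -
    have cent: "x \<otimes> x \<in> centralizer y" if "x \<in> H" for x
      using sq[OF that y] that y HG by (auto simp: centralizer_def)
    have yG: "y \<in> carrier G" and hG: "h \<in> carrier G" and gG: "g \<in> carrier G"
      using h g y HG by auto
    note C = subgroup_centralizer[OF yG]
    have e: "(h \<otimes> g) \<otimes> (h \<otimes> g) = (h \<otimes> g \<otimes> inv h \<otimes> inv g) \<otimes> (g \<otimes> (h \<otimes> h) \<otimes> g)"
      using hG gG by (simp add: m_assoc inv_solve_left) (simp add: m_assoc[symmetric])
    have "g \<otimes> (h \<otimes> h) \<otimes> g = (h \<otimes> h) \<otimes> g \<otimes> g"
      by (simp only: sq[OF h g])
    also have "\<dots> = (h \<otimes> h) \<otimes> (g \<otimes> g)"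
      using hG gG by (simp add: m_assoc)
    finally have "g \<otimes> (h \<otimes> h) \<otimes> g = (h \<otimes> h) \<otimes> (g \<otimes> g)" .
    then have g2: "g \<otimes> (h \<otimes> h) \<otimes> g \<in> centralizer y"
      using cent[OF h] cent[OF g] subgroup.m_closed[OF C] by simp
    have "h \<otimes> g \<otimes> inv h \<otimes> inv g = (h \<otimes> g) \<otimes> (h \<otimes> g) \<otimes> inv (g \<otimes> (h \<otimes> h) \<otimes> g)"
      unfolding e using hG gG by (simp add: m_assoc)
    then show ?thesis
      using subgroup.m_closed[OF C cent[OF mc[OF h g]] subgroup.m_inv_closed[OF C g2]] by simp
  qed
  have L1: "?L (Suc 0) = generate G ?S" unfolding lower_central_Suc_in[OF H] by simp
  have c1: "x \<otimes> y = y \<otimes> x" if x: "x \<in> ?L (Suc 0)" and y: "y \<in> H" for x y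
  proof -
    have "?S \<subseteq> centralizer y" using comm[OF _ _ y] by blast
    then have "generate G ?S \<subseteq> centralizer y"
      using generate_subgroup_incl subgroup_centralizer y HG by blast
    then show ?thesis using x unfolding L1 centralizer_def by auto
  qed
  have "?L (Suc (Suc 0)) \<subseteq> {\<one>}"
    unfolding lower_central_Suc_in(1)[OF H, of "Suc 0"]
  proof (rule generate_commutators_trivial[OF _ HG])
    show "?L (Suc 0) \<subseteq> carrier G" using lower_central_in_subset[OF H] HG by blast
  qed (use c1 in blast)
  moreover have "enat (Suc (Suc 0)) \<le> c"
    using assms(2) by (cases c) (auto simp: one_enat_def)
  ultimately show ?thesis using c_nilpotent_in_iff[OF H] by blast
qed

text \<open>
  A nontrivial nilpotent group has a nontrivial centre: the last nontrivial term of its lower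
  central series is central.  A central element of the group generated by \<open>x\<close> and \<open>y\<close> lies in
  both centralizers.
\<close>

lemma not_c_nilpotent_if_centralizers_disjoint:
  assumes x: "x \<in> carrier G" and y: "y \<in> carrier G" and "x \<noteq> \<one>"
    and triv: "centralizer x \<inter> centralizer y \<subseteq> {\<one>}"
  shows "\<not> c_nilpotent_in c G (generate G {x, y})"
proof
  let ?H = "generate G {x, y}"
  let ?L = "lower_central (G\<lparr>carrier := ?H\<rparr>)"
  assume nil: "c_nilpotent_in c G ?H"
  have S: "{x, y} \<subseteq> carrier G" using x y by auto
  have H: "subgroup ?H G" using generate_is_subgroup[OF S] .
  have xH: "x \<in> ?H" "y \<in> ?H" by (auto intro: generate.incl)
  obtain n where "?L n \<subseteq> {\<one>}" using nil c_nilpotent_in_iff[OF H] by blast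
  moreover have "\<not> ?L n \<subseteq> {\<one>}" for n
  proof (induction n)
    case 0 then show ?case using xH \<open>x \<noteq> \<one>\<close> by auto
  next
    case (Suc n)
    show ?case
    proof
      assume t: "?L (Suc n) \<subseteq> {\<one>}"
      obtain h where h: "h \<in> ?L n" "h \<noteq> \<one>" using Suc by blast
      have hG: "h \<in> carrier G"
        using h lower_central_in_subset[OF H] generate_incl[OF S] by blast
      have "h \<otimes> g \<otimes> inv h \<otimes> inv g = \<one>" if "g \<in> ?H" for g
      proof -
        have "h \<otimes> g \<otimes> inv h \<otimes> inv g \<in> ?L (Suc n)"
          unfolding lower_central_Suc_in[OF H] using h that by (intro generate.incl) auto
        then show ?thesis using t by blast
      qed
      then have "h \<otimes> x = x \<otimes> h" "h \<otimes> y = y \<otimes> h"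
        using xH x y hG by (simp_all add: commutator_eq_one_iff[symmetric])
      then have "h \<in> centralizer x" "h \<in> centralizer y"
        using hG by (auto simp: centralizer_def)
      then show False using triv h by blast
    qed
  qed
  ultimately show False by blast
qed

lemma one_nilpotent_imp_commute:
  assumes H: "subgroup H G" and nil: "c_nilpotent_in 1 G H" and "x \<in> H" "y \<in> H"
  shows "x \<otimes> y = y \<otimes> x"
proof -
  obtain n where n: "enat n \<le> 1" and t: "lower_central (G\<lparr>carrier := H\<rparr>) n \<subseteq> {\<one>}"
    using nil c_nilpotent_in_iff[OF H] by blast
  have xy: "x \<in> carrier G" "y \<in> carrier G" using assms subgroup.subset[OF H] by auto
  consider "n = 0" | "n = Suc 0" using n by (cases n) (auto simp: one_enat_def)
  then show ?thesis
  proof cases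
    case 1 then show ?thesis using t assms xy by auto
  next
    case 2
    have "x \<otimes> y \<otimes> inv x \<otimes> inv y \<in> lower_central (G\<lparr>carrier := H\<rparr>) (Suc 0)"
      unfolding lower_central_Suc_in[OF H] using assms by (intro generate.incl) auto
    then show ?thesis using t 2 commutator_eq_one_iff[OF xy] by blast
  qed
qed

section \<open>Covers and the maximal size of a non-nilpotent subset\<close>

text \<open>
  The distinguished elements \<open>e i\<close> form a non-nilpotent subset.  Conversely a non-nilpotent subset
  has at most one element in each member \<open>Y i\<close>, since two elements of \<open>Y i\<close> generate a subgroup
  of a \<open>c\<close>-nilpotent group.  The same remark shows that \<open>Y\<close> and \<open>e\<close> are injective on \<open>I\<close>, so that
  the cover can be counted by its index set.
\<close>

lemma two_minimal_cover_omega: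
  fixes Y :: "'i \<Rightarrow> 'a set" and e :: "'i \<Rightarrow> 'a"
  assumes fin: "finite I"
    and Y: "\<And>i. i \<in> I \<Longrightarrow> subgroup (Y i) G" "\<And>i. i \<in> I \<Longrightarrow> c_nilpotent_in c G (Y i)"
    and cover: "\<And>g. g \<in> carrier G \<Longrightarrow> \<exists>i\<in>I. g \<in> Y i"
    and e: "\<And>i. i \<in> I \<Longrightarrow> e i \<in> Y i"
    and non: "\<And>i j. i \<in> I \<Longrightarrow> j \<in> I \<Longrightarrow> i \<noteq> j \<Longrightarrow> \<not> c_nilpotent_in c G (generate G {e i, e j})"
  shows "(\<exists>N. c_nilpotent_cover c G N \<and> two_minimal c G N) \<and> omega c G = card I"
proof -
  have gen: "c_nilpotent_in c G (generate G {x, y})" if "i \<in> I" "x \<in> Y i" "y \<in> Y i" for i x y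
  proof (rule c_nilpotent_in_mono[OF _ Y(1)[OF that(1)] _ Y(2)[OF that(1)]])
    show "subgroup (generate G {x, y}) G"
      using that subgroup.subset[OF Y(1)[OF that(1)]] by (intro generate_is_subgroup) auto
    show "generate G {x, y} \<subseteq> Y i"
      using that by (intro generate_subgroup_incl[OF _ Y(1)]) auto
  qed
  have injY: "inj_on Y I"
  proof (rule inj_onI, rule ccontr)
    fix i j assume "i \<in> I" "j \<in> I" "Y i = Y j" "i \<noteq> j"
    then show False using non[of i j] gen[of i "e i" "e j"] e by auto
  qed
  have inje: "inj_on e I"
  proof (rule inj_onI, rule ccontr)
    fix i j assume ij: "i \<in> I" "j \<in> I" "e i = e j" "i \<noteq> j"
    have "c_nilpotent_in c G (generate G {e i, e j})"
      unfolding ij(3)[symmetric] using gen[OF ij(1) e[OF ij(1)] e[OF ij(1)]] .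
    then show False using non ij by blast
  qed
  have "c_nilpotent_cover c G (Y ` I)"
    unfolding c_nilpotent_cover_def using Y cover by auto
  moreover have "two_minimal c G (Y ` I)"
    unfolding two_minimal_def
  proof (intro exI[of _ "\<lambda>H. e (the_inv_into I Y H)"] conjI ballI impI)
    fix H assume "H \<in> Y ` I"
    then show "e (the_inv_into I Y H) \<in> H"
      using e by (auto simp: the_inv_into_f_f[OF injY])
  next
    fix H K assume "H \<in> Y ` I" "K \<in> Y ` I" "H \<noteq> K"
    then obtain i j where "i \<in> I" "j \<in> I" "H = Y i" "K = Y j" "i \<noteq> j" by blast
    then show "\<not> c_nilpotent_in c G (generate G {e (the_inv_into I Y H), e (the_inv_into I Y K)})"
      using non by (simp add: the_inv_into_f_f[OF injY])
  qed
  moreover have "omega c G = card I"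
    unfolding omega_def
  proof (rule Max_eqI)
    have bound: "card X \<le> card I" if X: "non_c_nilpotent_subset c G X" for X
    proof -
      have "\<forall>x\<in>X. \<exists>i\<in>I. x \<in> Y i"
        using X cover unfolding non_c_nilpotent_subset_def by blast
      then obtain f where f: "\<And>x. x \<in> X \<Longrightarrow> f x \<in> I \<and> x \<in> Y (f x)" by metis
      have "inj_on f X"
      proof (rule inj_onI, rule ccontr)
        fix x y assume "x \<in> X" "y \<in> X" "f x = f y" "x \<noteq> y"
        then show False
          using X gen[of "f x" x y] f unfolding non_c_nilpotent_subset_def by metis
      qed
      then show ?thesis using f fin by (intro card_inj_on_le) auto
    qed
    show "finite {card X |X. finite X \<and> non_c_nilpotent_subset c G X}"
      by (rule finite_subset[of _ "{..card I}"]) (use bound in auto)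
    show "n \<le> card I" if "n \<in> {card X |X. finite X \<and> non_c_nilpotent_subset c G X}" for n
      using that bound by auto
    have "non_c_nilpotent_subset c G (e ` I)"
      unfolding non_c_nilpotent_subset_def
    proof (intro conjI ballI impI)
      show "e ` I \<subseteq> carrier G" using e subgroup.subset[OF Y(1)] by blast
    next
      fix x y assume "x \<in> e ` I" "y \<in> e ` I" "x \<noteq> y"
      then obtain i j where "i \<in> I" "j \<in> I" "x = e i" "y = e j" "i \<noteq> j" by blast
      then show "\<not> c_nilpotent_in c G (generate G {x, y})" using non by simp
    qed
    then show "card I \<in> {card X |X. finite X \<and> non_c_nilpotent_subset c G X}"
      using fin by (intro CollectI exI[of _ "e ` I"]) (simp add: card_image[OF inje])
  qed
  ultimately show ?thesis by blast
qed

end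

section \<open>Projective general linear groups\<close>

lemma mat_mult_nth: "(mat k ** A) $ i $ j = k * (A :: 'a::field^'n^'n) $ i $ j"
  by (simp add: matrix_matrix_mult_def mat_def mult_delta_left)

lemma mult_mat_nth: "(A ** mat k) $ i $ j = k * (A :: 'a::field^'n^'n) $ i $ j"
  by (simp add: matrix_matrix_mult_def mat_def mult_delta_right mult.commute)

lemma mat_mult_mat: "mat a ** mat b = (mat (a * b) :: 'a::field^'n^'n)"
  by (simp add: vec_eq_iff mat_mult_nth) (simp add: mat_def)

lemma mat_central: "A ** mat k = mat k ** (A :: 'a::field^'n^'n)"
  by (simp add: vec_eq_iff mat_mult_nth mult_mat_nth)

lemma invertible_mat: "k \<noteq> 0 \<Longrightarrow> invertible (mat k :: 'a::field^'n^'n)"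
  unfolding invertible_def by (intro exI[of _ "mat (inverse k)"]) (simp add: mat_mult_mat)

lemma group_GL: "group (GL :: ('a::field^'n^'n) monoid)"
proof (rule groupI)
  fix A :: "'a^'n^'n" assume "A \<in> carrier GL"
  then obtain B where B: "A ** B = mat 1" "B ** A = mat 1"
    by (auto simp: GL_def invertible_def)
  then have "B \<in> carrier GL" by (auto simp: GL_def invertible_def)
  then show "\<exists>B\<in>carrier GL. B \<otimes>\<^bsub>GL\<^esub> A = \<one>\<^bsub>GL\<^esub>" using B by (auto simp: GL_def)
qed (auto simp: GL_def invertible_mult matrix_mul_assoc invertible_mat)

lemma normal_nonzero_scalars: "(nonzero_scalars :: ('a::field^'n^'n) set) \<lhd> GL"
proof -
  interpret group "GL :: ('a^'n^'n) monoid" by (rule group_GL)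
  have "subgroup (nonzero_scalars :: ('a^'n^'n) set) GL"
  proof (rule subgroupI)
    show "(nonzero_scalars :: ('a^'n^'n) set) \<subseteq> carrier GL"
      by (auto simp: nonzero_scalars_def GL_def invertible_mat)
    show "(nonzero_scalars :: ('a^'n^'n) set) \<noteq> {}"
      by (auto simp: nonzero_scalars_def intro: exI[of _ 1])
  next
    fix A :: "'a^'n^'n" assume "A \<in> nonzero_scalars"
    then obtain k where k: "A = mat k" "k \<noteq> 0" by (auto simp: nonzero_scalars_def)
    have "inv\<^bsub>GL\<^esub> A = mat (inverse k)"
      by (rule inv_equality) (use k in \<open>auto simp: GL_def mat_mult_mat invertible_mat\<close>)
    then show "inv\<^bsub>GL\<^esub> A \<in> nonzero_scalars" using k by (auto simp: nonzero_scalars_def)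
  next
    fix A B :: "'a^'n^'n" assume "A \<in> nonzero_scalars" "B \<in> nonzero_scalars"
    then show "A \<otimes>\<^bsub>GL\<^esub> B \<in> nonzero_scalars"
      by (fastforce simp: nonzero_scalars_def GL_def mat_mult_mat)
  qed
  moreover have "nonzero_scalars #>\<^bsub>GL\<^esub> A = A <#\<^bsub>GL\<^esub> nonzero_scalars" for A :: "'a^'n^'n"
    by (auto simp: r_coset_def l_coset_def nonzero_scalars_def GL_def mat_central[of A])
  ultimately show ?thesis by (intro normalI) auto
qed

lemma group_PGL: "group (PGL :: ('a::field^'n^'n) set monoid)"
  unfolding PGL_def by (rule normal.factorgroup_is_group[OF normal_nonzero_scalars])

definition proj_class :: "'a::field^'n^'n \<Rightarrow> ('a^'n^'n) set" where
  "proj_class A = nonzero_scalars #>\<^bsub>GL\<^esub> A"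

lemma carrier_PGL: "carrier PGL = proj_class ` {A. invertible A}"
  by (simp add: PGL_def carrier_FactGroup GL_def proj_class_def[abs_def])

lemma proj_class_in_carrier: "invertible A \<Longrightarrow> proj_class A \<in> carrier PGL"
  by (auto simp: carrier_PGL)

lemma proj_class_mult:
  assumes "invertible A" "invertible B"
  shows "proj_class A \<otimes>\<^bsub>PGL\<^esub> proj_class B = proj_class (A ** B)"
  using normal.rcos_sum[OF normal_nonzero_scalars, of A B] assms
  by (simp add: PGL_def proj_class_def GL_def)

lemma proj_class_iff: "B \<in> proj_class A \<longleftrightarrow> (\<exists>k. k \<noteq> 0 \<and> B = mat k ** A)"
  by (auto simp: proj_class_def r_coset_def nonzero_scalars_def GL_def)

lemma proj_class_eq_iff: "proj_class A = proj_class B \<longleftrightarrow> (\<exists>k. k \<noteq> 0 \<and> A = mat k ** B)"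
proof
  assume "proj_class A = proj_class B"
  moreover have "A \<in> proj_class A" unfolding proj_class_iff by (intro exI[of _ 1]) simp
  ultimately show "\<exists>k. k \<noteq> 0 \<and> A = mat k ** B" using proj_class_iff by blast
next
  assume "\<exists>k. k \<noteq> 0 \<and> A = mat k ** B"
  then obtain k where k: "k \<noteq> 0" "A = mat k ** B" by blast
  have sub: "proj_class (mat l ** C) \<subseteq> proj_class C" if l: "l \<noteq> 0" for l :: 'a and C :: "'a^'b^'b"
  proof
    fix D assume "D \<in> proj_class (mat l ** C)"
    then obtain m where "m \<noteq> 0" "D = mat (m * l) ** C"
      by (auto simp: proj_class_iff matrix_mul_assoc mat_mult_mat)
    then show "D \<in> proj_class C" unfolding proj_class_iff using l by (intro exI[of _ "m * l"]) simp
  qed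
  have "B = mat (inverse k) ** A" using k by (simp add: matrix_mul_assoc mat_mult_mat)
  then have "proj_class B \<subseteq> proj_class A" using sub[of "inverse k" A] k(1) by simp
  then show "proj_class A = proj_class B" using sub[OF k(1), of B] k(2) by simp
qed

lemma proj_class_one: "\<one>\<^bsub>PGL\<^esub> = proj_class (mat 1 :: 'a::field^'n^'n)"
  by (auto simp: PGL_def proj_class_def r_coset_def nonzero_scalars_def GL_def)

lemma proj_class_eq_one_iff: "proj_class A = \<one>\<^bsub>PGL\<^esub> \<longleftrightarrow> (\<exists>k. k \<noteq> 0 \<and> A = mat k)"
  by (simp add: proj_class_one proj_class_eq_iff)

lemma proj_class_commute_iff:
  assumes "invertible A" "invertible B"
  shows "proj_class A \<otimes>\<^bsub>PGL\<^esub> proj_class B = proj_class B \<otimes>\<^bsub>PGL\<^esub> proj_class A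
    \<longleftrightarrow> (\<exists>k. k \<noteq> 0 \<and> A ** B = mat k ** (B ** A))"
  by (simp add: proj_class_mult assms proj_class_eq_iff)

text \<open>
  The image of the units of the algebra of matrices commuting with \<open>P\<close>.  For a nonscalar
  two-by-two matrix this is a torus, split or not, or, when the characteristic polynomial of \<open>P\<close>
  has a double root in the field, a group of transvections.
\<close>

definition torus :: "'a::field^'n^'n \<Rightarrow> ('a^'n^'n) set set" where
  "torus P = proj_class ` {B. invertible B \<and> B ** P = P ** B}"

lemma subgroup_torus: "subgroup (torus (P :: 'a::field^'n^'n)) PGL"
proof -
  interpret group "PGL :: ('a^'n^'n) set monoid" by (rule group_PGL)
  show ?thesis
  proof (rule subgroupI)
    show "torus P \<subseteq> carrier PGL" by (auto simp: torus_def proj_class_in_carrier)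
    show "torus P \<noteq> {}"
      by (auto simp: torus_def mat_central[of P] intro!: exI[of _ "mat 1"] invertible_mat)
  next
    fix g assume "g \<in> torus P"
    then obtain B where B: "g = proj_class B" "invertible B" "B ** P = P ** B" by (auto simp: torus_def)
    obtain C where C: "B ** C = mat 1" "C ** B = mat 1" using B by (auto simp: invertible_def)
    have iC: "invertible C" using C by (auto simp: invertible_def)
    have "C ** P = C ** P ** (B ** C)" by (simp add: C)
    also have "\<dots> = C ** (P ** B) ** C" by (simp add: matrix_mul_assoc)
    also have "\<dots> = C ** B ** P ** C" by (simp add: B(3)[symmetric] matrix_mul_assoc)
    also have "\<dots> = P ** C" by (simp add: C)
    finally have "proj_class C \<in> torus P" using iC by (auto simp: torus_def)
    moreover have "inv\<^bsub>PGL\<^esub> g = proj_class C"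
      by (rule inv_equality) (use B iC C in \<open>simp_all add: proj_class_mult proj_class_one proj_class_in_carrier\<close>)
    ultimately show "inv\<^bsub>PGL\<^esub> g \<in> torus P" by simp
  next
    fix g h assume "g \<in> torus P" "h \<in> torus P"
    then obtain A B where AB: "g = proj_class A" "h = proj_class B" "invertible A" "invertible B"
      "A ** P = P ** A" "B ** P = P ** B" by (auto simp: torus_def)
    have "A ** B ** P = A ** (P ** B)" by (simp add: matrix_mul_assoc[symmetric] AB(6))
    also have "\<dots> = P ** (A ** B)" by (simp add: matrix_mul_assoc AB(5))
    finally have "(A ** B) ** P = P ** (A ** B)" .
    then show "g \<otimes>\<^bsub>PGL\<^esub> h \<in> torus P"
      using AB by (auto simp: torus_def proj_class_mult invertible_mult)
  qed
qed

section \<open>The planes through the scalar matrices\<close>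

definition mat2 :: "'a::zero \<Rightarrow> 'a \<Rightarrow> 'a \<Rightarrow> 'a \<Rightarrow> 'a^2^2" where
  "mat2 a b c d = vector [vector [a, b], vector [c, d]]"

lemma mat2_nth [simp]:
  "mat2 a b c d $ 1 $ 1 = a" "mat2 a b c d $ 1 $ 2 = b"
  "mat2 a b c d $ 2 $ 1 = c" "mat2 a b c d $ 2 $ 2 = d"
  by (simp_all add: mat2_def)

lemma mat2_ext: "A = B \<longleftrightarrow> A $ 1 $ 1 = B $ 1 $ 1 \<and> A $ 1 $ 2 = B $ 1 $ 2 \<and>
    A $ 2 $ 1 = B $ 2 $ 1 \<and> A $ 2 $ 2 = (B :: 'a^2^2) $ 2 $ 2"
  by (auto simp: vec_eq_iff forall_2)

lemma mat2_eq_iff [simp]: "mat2 a b c d = mat2 a' b' c' d' \<longleftrightarrow> a = a' \<and> b = b' \<and> c = c' \<and> d = d'"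
  by (simp add: mat2_ext)

lemma mat2_exhaust: obtains a b c d where "A = mat2 a b c d"
  by (rule that[of "A$1$1" "A$1$2" "A$2$1" "A$2$2"]) (simp add: mat2_ext)

lemma mat2_mult: "mat2 a b c d ** mat2 a' b' c' d' =
    mat2 (a * a' + b * c') (a * b' + b * d') (c * a' + d * c') (c * b' + d * (d'::'a::semiring_1))"
  by (simp add: mat2_ext matrix_matrix_mult_def sum_2)

lemma mat_eq_mat2: "(mat k :: 'a::zero^2^2) = mat2 k 0 0 k"
  by (simp add: mat2_ext mat_def)

lemma mat2_add: "mat2 a b c d + mat2 a' b' c' d' = mat2 (a + a') (b + b') (c + c') (d + (d'::'a::monoid_add))"
  by (simp add: mat2_ext)

lemma det_mat2: "det (mat2 a b c d) = a * d - b * (c::'a::comm_ring_1)"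
  by (simp add: det_2)

lemma trace_mat2: "trace (mat2 a b c d) = a + (d::'a::semiring_1)"
  by (simp add: trace_def sum_2)

lemma invertible_mat2: "invertible (mat2 a b c d) \<longleftrightarrow> a * d - b * (c::'a::field) \<noteq> 0"
  by (simp add: invertible_det_nz det_mat2)

lemmas mat2_simps = mat2_mult mat_eq_mat2 mat2_add det_mat2 trace_mat2 invertible_mat2

text \<open>
  One representative of each line in the quotient of the matrix space by the scalars, that is, of
  each point of a projective plane.  Each class modulo scalars has one member whose upper left
  entry is \<open>0\<close>; the remaining entries are homogeneous coordinates, normalized so that the first nonzero one is \<open>1\<close>.
\<close>

definition plane_reps :: "('a::field^2^2) set" where
  "plane_reps = range (\<lambda>(c, d). mat2 0 1 c d) \<union> range (\<lambda>d. mat2 0 0 1 d) \<union> {mat2 0 0 0 1}"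

lemma repsE:
  assumes "P \<in> plane_reps"
  obtains c d where "P = mat2 0 1 c d" | d where "P = mat2 0 0 1 d" | "P = mat2 0 0 0 1"
  using assms by (auto simp: plane_reps_def)

lemma card_reps:
  "card (plane_reps :: ('a::{field, finite}^2^2) set) = CARD('a)\<^sup>2 + CARD('a) + 1"
proof -
  let ?A = "range (\<lambda>(c, d). mat2 0 1 c d) :: ('a^2^2) set"
  let ?B = "range (\<lambda>d. mat2 0 0 1 d) :: ('a^2^2) set"
  have A: "card ?A = CARD('a)\<^sup>2"
    by (subst card_image) (auto simp: inj_on_def card_prod power2_eq_square)
  have B: "card ?B = CARD('a)"
    by (subst card_image) (auto simp: inj_on_def)
  have AB: "card (?A \<union> ?B) = CARD('a)\<^sup>2 + CARD('a)"
    by (subst card_Un_disjoint) (auto simp: A B)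
  show ?thesis unfolding plane_reps_def
    by (subst card_Un_disjoint) (auto simp: AB)
qed

lemma plane_reps_parallel:
  assumes "P \<in> plane_reps" "Q \<in> plane_reps" "mat y ** P = mat z ** Q" "y \<noteq> 0"
  shows "P = Q"
  using assms by (auto elim!: repsE simp: mat2_simps)

lemma plane_cover:
  fixes B :: "'a::field^2^2"
  obtains P x y where "P \<in> plane_reps" "B = mat x + mat y ** P"
proof -
  obtain a b c d where B: "B = mat2 a b c d" by (rule mat2_exhaust)
  consider "b \<noteq> 0" | "b = 0" "c \<noteq> 0" | "b = 0" "c = 0" by blast
  then show ?thesis
  proof cases
    case 1
    then show ?thesis
      using B by (intro that[of "mat2 0 1 (c / b) ((d - a) / b)" a b]) (auto simp: plane_reps_def mat2_simps)
  next
    case 2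
    then show ?thesis
      using B by (intro that[of "mat2 0 0 1 ((d - a) / c)" a c]) (auto simp: plane_reps_def mat2_simps)
  next
    case 3
    then show ?thesis
      using B by (intro that[of "mat2 0 0 0 1" a "d - a"]) (auto simp: plane_reps_def mat2_simps)
  qed
qed

lemma plane_commutes:
  fixes P :: "'a::field^2^2"
  shows "(mat x + mat y ** P) ** (mat z + mat w ** P) = (mat z + mat w ** P) ** (mat x + mat y ** P)"
  by (rule mat2_exhaust[of P]) (simp add: mat2_simps algebra_simps)

text \<open>
  A nonscalar two-by-two matrix is cyclic, so that its commutant consists of the polynomials in it.
\<close>

lemma commutant_reps:
  assumes "P \<in> plane_reps" "B ** P = P ** B"
  obtains x y where "B = mat x + mat y ** P"
proof -
  obtain a b c d where B: "B = mat2 a b c d" by (rule mat2_exhaust)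
  from assms(1) show ?thesis
  proof (cases rule: repsE)
    case (1 u v)
    then have "c = b * u" "d = a + b * v" using assms(2) by (simp_all add: B mat2_mult)
    then show ?thesis by (intro that[of a b]) (simp add: B 1 mat2_simps)
  next
    case (2 v)
    then have "b = 0" "d = a + v * c" using assms(2) by (simp_all add: B mat2_mult)
    then show ?thesis by (intro that[of a c]) (simp add: B 2 mat2_simps)
  next
    case 3
    then have "b = 0" "c = 0" using assms(2) by (simp_all add: B mat2_mult)
    then show ?thesis by (intro that[of a "d - a"]) (simp add: B 3 mat2_simps)
  qed
qed

lemma torus_reps:
  assumes P: "P \<in> plane_reps"
  shows "torus P = {proj_class (mat x + mat y ** P) |x y. invertible (mat x + mat y ** P)}"
proof -
  have comm: "(mat x + mat y ** P) ** P = P ** (mat x + mat y ** P)" for x y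
    by (rule mat2_exhaust[of P]) (simp add: mat2_simps algebra_simps)
  show ?thesis
  proof
    show "torus P \<subseteq> {proj_class (mat x + mat y ** P) |x y. invertible (mat x + mat y ** P)}"
    proof
      fix g assume "g \<in> torus P"
      then obtain B where B: "g = proj_class B" "invertible B" "B ** P = P ** B" by (auto simp: torus_def)
      obtain x y where "B = mat x + mat y ** P" by (rule commutant_reps[OF P B(3)])
      then show "g \<in> {proj_class (mat x + mat y ** P) |x y. invertible (mat x + mat y ** P)}"
        using B by blast
    qed
    show "{proj_class (mat x + mat y ** P) |x y. invertible (mat x + mat y ** P)} \<subseteq> torus P"
      unfolding torus_def using comm by blast
  qed
qed

lemma torus_abelian:
  assumes P: "P \<in> plane_reps" and "g \<in> torus P" "h \<in> torus P"
  shows "g \<otimes>\<^bsub>PGL\<^esub> h = h \<otimes>\<^bsub>PGL\<^esub> g"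
  using assms(2,3) unfolding torus_reps[OF P]
  by (auto simp: proj_class_mult plane_commutes)

lemma torus_cover:
  fixes g :: "('a::field^2^2) set"
  assumes "g \<in> carrier PGL"
  obtains P where "P \<in> plane_reps" "g \<in> torus P"
proof -
  obtain B where B: "invertible B" "g = proj_class B" using assms by (auto simp: carrier_PGL)
  obtain P x y where P: "P \<in> plane_reps" "B = mat x + mat y ** P" by (rule plane_cover)
  show ?thesis using B P by (intro that[of P]) (auto simp: torus_reps)
qed

text \<open>
  Two distinct planes through the line of scalar matrices meet in that line only.
\<close>

lemma torus_inter:
  fixes P Q :: "'a::field^2^2"
  assumes P: "P \<in> plane_reps" and Q: "Q \<in> plane_reps" and "P \<noteq> Q" "g \<in> torus P" "g \<in> torus Q"
  shows "g = \<one>\<^bsub>PGL\<^esub>"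
proof -
  obtain x y where g: "g = proj_class (mat x + mat y ** P)" and i: "invertible (mat x + mat y ** P)"
    using assms by (auto simp: torus_reps)
  obtain z w where h: "g = proj_class (mat z + mat w ** Q)"
    using assms by (auto simp: torus_reps)
  obtain k where k: "k \<noteq> 0" "mat x + mat y ** P = mat k ** (mat z + mat w ** Q)"
    using g h proj_class_eq_iff by metis
  have P11: "P $ 1 $ 1 = 0" and Q11: "Q $ 1 $ 1 = 0" using P Q by (auto elim: repsE)
  have e: "mat y ** P = mat (k * w) ** Q"
    using k(2) P11 Q11
    by (cases P rule: mat2_exhaust, cases Q rule: mat2_exhaust) (auto simp: mat2_simps algebra_simps)
  have "y = 0"
    using plane_reps_parallel[OF P Q e] \<open>P \<noteq> Q\<close> by blast
  then have m: "mat x + mat y ** P = mat x"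
    by (cases P rule: mat2_exhaust) (simp add: mat2_simps)
  then have "x \<noteq> 0" using i by (auto simp: mat2_simps)
  then show ?thesis using g m proj_class_eq_one_iff by metis
qed

section \<open>Regular elements and their centralizers\<close>

lemma matrix_add_rdistrib: "(A + B) ** C = A ** C + B ** (C :: 'a::semiring_1^'n^'m)"
  by (simp add: matrix_matrix_mult_def vec_eq_iff distrib_right sum.distrib)

lemma trace_mat_mult: "trace (mat k ** A) = k * trace (A :: 'a::field^'n^'n)"
  by (simp add: trace_def mat_mult_nth sum_distrib_left)

lemma det_mat_mult: "det (mat k ** A) = k\<^sup>2 * det (A :: 'a::field^2^2)"
  by (simp add: det_2 mat_mult_nth algebra_simps power2_eq_square)

text \<open>
  If \<open>A B = k B A\<close>, then \<open>A\<close> is conjugate to \<open>k A\<close>.  Comparing traces gives \<open>k = 1\<close> if the trace of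
  \<open>A\<close> is nonzero; comparing determinants gives \<open>k\<^sup>2 = 1\<close>, which suffices in characteristic two.
\<close>

lemma projective_commute_imp_commute:
  fixes A B :: "'a::field^2^2"
  assumes B: "invertible B" and A: "invertible A" "trace A \<noteq> 0 \<or> (2::'a) = 0"
    and k: "A ** B = mat k ** (B ** A)"
  shows "A ** B = B ** A"
proof -
  obtain C where C: "B ** C = mat 1" "C ** B = mat 1" using B by (auto simp: invertible_def)
  have "A = A ** (B ** C)" by (simp add: C)
  also have "\<dots> = mat k ** B ** A ** C" by (simp add: k matrix_mul_assoc)
  finally have e: "A = mat k ** (B ** (A ** C))" by (simp add: matrix_mul_assoc)
  have "trace (B ** (A ** C)) = trace A"
    by (subst trace_mul_sym) (simp add: matrix_mul_assoc[symmetric] C)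
  then have "trace A = k * trace A"
    using trace_mat_mult[of k "B ** (A ** C)"] e by simp
  moreover have "det A \<noteq> 0" "det (B ** A) \<noteq> 0" "det (A ** B) = det (B ** A)"
    using A B by (simp_all add: invertible_det_nz det_mul)
  then have "det (B ** A) = k\<^sup>2 * det (B ** A)"
    using k det_mat_mult[of k "B ** A"] by simp
  then have "k\<^sup>2 = 1" using \<open>det (B ** A) \<noteq> 0\<close> by simp
  then have "k = 1 \<or> k = -1" by (simp add: power2_eq_1_iff)
  moreover have "(- 1 :: 'a) = 1" if "(2::'a) = 0"
    using that by (metis add_eq_0_iff one_add_one)
  ultimately have "k = 1" using A(2) by auto
  then show ?thesis using k by simp
qed

text \<open>
  An invertible nonscalar matrix fails to be regular precisely when the characteristic is odd and
  its projective class is an involution; the centralizer of the class is then larger than its torus.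
\<close>

definition regular :: "'a::field^2^2 \<Rightarrow> bool" where
  "regular A \<longleftrightarrow> invertible A \<and> (trace A \<noteq> 0 \<or> (2::'a) = 0)"

lemma centralizer_regular:
  assumes P: "P \<in> plane_reps" and A: "regular A" "A = mat x + mat y ** P" "y \<noteq> 0"
  shows "group.centralizer PGL (proj_class A) = torus P"
proof -
  interpret group "PGL :: ('a^2^2) set monoid" by (rule group_PGL)
  have iA: "invertible A" using A(1) by (simp add: regular_def)
  then have inA: "proj_class A \<in> torus P" using A(2) by (auto simp: torus_reps[OF P])
  show ?thesis
  proof
    show "torus P \<subseteq> centralizer (proj_class A)"
      using torus_abelian[OF P inA] subgroup.subset[OF subgroup_torus] by (auto simp: centralizer_def)
  next
    show "centralizer (proj_class A) \<subseteq> torus P"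
    proof
      fix g assume g: "g \<in> centralizer (proj_class A)"
      then obtain B where B: "invertible B" "g = proj_class B" by (auto simp: centralizer_def carrier_PGL)
      have "proj_class A \<otimes>\<^bsub>PGL\<^esub> proj_class B = proj_class B \<otimes>\<^bsub>PGL\<^esub> proj_class A" using g B by (simp add: centralizer_def)
      then obtain k where "A ** B = mat k ** (B ** A)"
        using proj_class_commute_iff[OF iA B(1)] by blast
      then have "A ** B = B ** A"
        using projective_commute_imp_commute[OF B(1) iA] A(1) by (auto simp: regular_def)
      then have "B ** P = P ** B"
      proof -
        have "A ** B = mat x ** B + mat y ** (P ** B)" "B ** A = mat x ** B + mat y ** (B ** P)"
          unfolding A(2) matrix_add_ldistrib matrix_add_rdistrib
          by (simp_all add: matrix_mul_assoc mat_central[of B])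
        then have "mat y ** (B ** P) = mat y ** (P ** B)" using \<open>A ** B = B ** A\<close> by simp
        then show ?thesis using A(3) by (simp add: vec_eq_iff mat_mult_nth)
      qed
      then show "g \<in> torus P" using B by (auto simp: torus_def)
    qed
  qed
qed

text \<open>
  A plane is counted if it contains a regular nonscalar matrix.  Up to a scalar factor such a
  matrix has the form \<open>mat t + P\<close>.
\<close>

definition regular_planes :: "('a::field^2^2) set" where
  "regular_planes = {P \<in> plane_reps. \<exists>t. regular (mat t + P)}"

lemma regular_planeI:
  assumes P: "P \<in> plane_reps" and A: "regular A" "A = mat x + mat y ** P" "y \<noteq> 0"
  shows "P \<in> regular_planes"
proof -
  have e: "mat (x / y) + P = mat (inverse y) ** A"
    using A(2,3) by (simp add: matrix_add_ldistrib matrix_mul_assoc mat_mult_mat divide_inverse mult.commute)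
  have "regular (mat (x / y) + P)"
    using A(1,3) unfolding e by (auto simp: regular_def invertible_det_nz det_mat_mult trace_mat_mult)
  then show ?thesis using P by (auto simp: regular_planes_def)
qed

lemma regular_plane_exists:
  assumes "regular A" "proj_class A \<noteq> \<one>\<^bsub>PGL\<^esub>"
  obtains P where "P \<in> regular_planes" "proj_class A \<in> torus P"
proof -
  obtain P x y where P: "P \<in> plane_reps" "A = mat x + mat y ** P" by (rule plane_cover)
  have iA: "invertible A" using assms(1) by (simp add: regular_def)
  have "y \<noteq> 0"
  proof
    assume "y = 0"
    then have "A = mat x" using P(2) by (cases P rule: mat2_exhaust) (simp add: mat2_simps)
    moreover have "x \<noteq> 0" using iA calculation by (auto simp: mat2_simps)
    ultimately show False using assms(2) proj_class_eq_one_iff by blast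
  qed
  then show ?thesis
    using P iA regular_planeI[OF P(1) assms(1) P(2)] by (intro that[of P]) (auto simp: torus_reps)
qed

lemma regular_elements:
  "\<exists>e :: 'a::field^2^2 \<Rightarrow> ('a^2^2) set. \<forall>P\<in>regular_planes.
    e P \<in> torus P \<and> e P \<noteq> \<one>\<^bsub>PGL\<^esub> \<and> group.centralizer PGL (e P) = torus P"
proof -
  have "\<exists>g\<in>torus P. g \<noteq> \<one>\<^bsub>PGL\<^esub> \<and> group.centralizer PGL g = torus P"
    if PR: "P \<in> regular_planes" for P :: "'a^2^2"
  proof -
    obtain t where P: "P \<in> plane_reps" and t: "regular (mat t + P)"
      using PR by (auto simp: regular_planes_def)
    have e: "mat t + P = mat t + mat 1 ** P" by simp
    have "mat t + P \<noteq> mat k" for k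
      using P by (auto elim!: repsE simp: mat2_simps)
    then have "proj_class (mat t + P) \<noteq> \<one>\<^bsub>PGL\<^esub>" by (simp add: proj_class_eq_one_iff)
    moreover have "proj_class (mat t + P) \<in> torus P"
      unfolding torus_reps[OF P] using t
      by (intro CollectI exI[of _ t] exI[of _ 1]) (simp add: regular_def)
    ultimately show ?thesis using centralizer_regular[OF P t e] by auto
  qed
  then show ?thesis by metis
qed

lemma regular_elements_not_nilpotent:
  fixes P Q :: "'a::field^2^2"
  assumes PQ: "P \<in> plane_reps" "Q \<in> plane_reps" "P \<noteq> Q"
    and g: "g \<in> torus P" "g \<noteq> \<one>\<^bsub>PGL\<^esub>" "group.centralizer PGL g = torus P"
    and h: "h \<in> torus Q" "group.centralizer PGL h = torus Q"
  shows "\<not> c_nilpotent_in c PGL (generate PGL {g, h})"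
proof -
  interpret group "PGL :: ('a^2^2) set monoid" by (rule group_PGL)
  show ?thesis
  proof (rule not_c_nilpotent_if_centralizers_disjoint)
    show "g \<in> carrier PGL" "h \<in> carrier PGL"
      using g h subgroup.subset[OF subgroup_torus] by blast+
    show "centralizer g \<inter> centralizer h \<subseteq> {\<one>\<^bsub>PGL\<^esub>}"
      using torus_inter[OF PQ] g h by auto
  qed (rule g)
qed

lemma torus_c_nilpotent:
  assumes "P \<in> plane_reps" "1 \<le> c"
  shows "c_nilpotent_in c PGL (torus P)"
  using group.c_nilpotent_in_abelian[OF group_PGL subgroup_torus assms(2)] torus_abelian[OF assms(1)]
  by blast

text \<open>
  The covering hypothesis holds over every finite field except the one with three elements: there the
  involutions of the split tori are not covered by tori of regular elements.
\<close>

lemma regular_tori_cover: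
  fixes c :: enat
  assumes c: "1 \<le> c"
    and cover: "\<And>g. g \<in> carrier (PGL :: ('a::{field, finite}^2^2) set monoid) \<Longrightarrow>
      \<exists>P\<in>regular_planes. g \<in> torus P"
  shows "(\<exists>N. c_nilpotent_cover c PGL N \<and> two_minimal c (PGL :: ('a^2^2) set monoid) N) \<and>
    omega c (PGL :: ('a^2^2) set monoid) = card (regular_planes :: ('a^2^2) set)"
proof -
  interpret group "PGL :: ('a^2^2) set monoid" by (rule group_PGL)
  obtain e :: "'a^2^2 \<Rightarrow> ('a^2^2) set" where e:
    "\<And>P. P \<in> regular_planes \<Longrightarrow> e P \<in> torus P"
    "\<And>P. P \<in> regular_planes \<Longrightarrow> e P \<noteq> \<one>\<^bsub>PGL\<^esub>"
    "\<And>P. P \<in> regular_planes \<Longrightarrow> centralizer (e P) = torus P"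
    using regular_elements[where ?'a = 'a] by blast
  have plane_reps: "P \<in> plane_reps" if "P \<in> regular_planes" for P :: "'a^2^2"
    using that by (simp add: regular_planes_def)
  show ?thesis
  proof (rule two_minimal_cover_omega[of regular_planes torus c e])
    fix P Q :: "'a^2^2"
    assume "P \<in> regular_planes" "Q \<in> regular_planes" "P \<noteq> Q"
    then show "\<not> c_nilpotent_in c PGL (generate PGL {e P, e Q})"
      using e plane_reps by (intro regular_elements_not_nilpotent[of P Q]) auto
  qed (use cover e plane_reps c in \<open>auto intro: subgroup_torus torus_c_nilpotent\<close>)
qed

section \<open>Fields with at least four or with two elements\<close>

text \<open>
  Among the matrices \<open>mat t + P\<close> at most two are singular, because the determinant is a quadratic
  polynomial in \<open>t\<close>, and outside characteristic two exactly one has trace zero.  So at most three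
  values of \<open>t\<close> are excluded.
\<close>

lemma regular_planes_large:
  assumes "CARD('a::{field, finite}) \<ge> 4"
  shows "(regular_planes :: ('a^2^2) set) = plane_reps"
proof -
  have "\<exists>t. regular (mat t + P)" if PR: "P \<in> plane_reps" for P :: "'a^2^2"
  proof -
    obtain b c d where P: "P = mat2 0 b c d" using PR by (auto elim: repsE)
    let ?D = "{t. poly [:- b * c, d, 1:] t = 0}"
    let ?T = "{t. (2::'a) \<noteq> 0 \<and> 2 * t + d = 0}"
    have "card ?D \<le> 2"
      using card_poly_roots_bound[of "[:- b * c, d, 1:]"] by simp
    moreover have "?T \<subseteq> {- d / 2}"
      by (auto simp: field_simps add_eq_0_iff)
    then have "card ?T \<le> 1" using card_mono[of "{- d / 2}" ?T] by simp
    ultimately have "card (?D \<union> ?T) < CARD('a)"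
      using assms card_Un_le[of ?D ?T] by linarith
    then have "?D \<union> ?T \<noteq> UNIV" by (metis less_irrefl)
    then obtain t where "t \<notin> ?D \<union> ?T" by blast
    then have "regular (mat t + P)"
      by (auto simp: P regular_def mat2_simps algebra_simps)
    then show ?thesis by blast
  qed
  then show ?thesis by (auto simp: regular_planes_def)
qed

lemma PGL_large:
  fixes c :: enat
  assumes "1 \<le> c" "CARD('a::{field, finite}) \<ge> 4"
  shows "(\<exists>N. c_nilpotent_cover c PGL N \<and> two_minimal c (PGL :: ('a^2^2) set monoid) N) \<and>
    omega c (PGL :: ('a^2^2) set monoid) = CARD('a)\<^sup>2 + CARD('a) + 1"
proof -
  have "\<exists>P\<in>regular_planes. g \<in> torus P" if "g \<in> carrier PGL" for g :: "('a^2^2) set"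
    using torus_cover[OF that] regular_planes_large[OF assms(2)] by metis
  from regular_tori_cover[OF assms(1) this] show ?thesis
    by (simp add: regular_planes_large[OF assms(2)] card_reps)
qed

text \<open>
  In characteristic two all elements are regular, so the tori still cover.  The planes that are
  lost are the three whose only unit is the identity: the split tori of order one.
\<close>

lemma PGL_two:
  fixes c :: enat
  assumes c: "1 \<le> c" and q: "CARD('a::{field, finite}) = 2"
  shows "(\<exists>N. c_nilpotent_cover c PGL N \<and> two_minimal c (PGL :: ('a^2^2) set monoid) N) \<and>
    omega c (PGL :: ('a^2^2) set monoid) = 4"
proof -
  have "{0, 1} = (UNIV :: 'a set)" by (rule card_seteq) (simp_all add: q)
  then have F: "x = 0 \<or> x = 1" for x :: 'a by blast
  have two: "(2::'a) = 0" 
    using F[of 2] by (metis add_cancel_right_right one_add_one zero_neq_one)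
  have minus: "- x = x" for x :: 'a
    using two by (metis add_eq_0_iff mult_2 mult_zero_left)
  have ex: "(\<exists>t. Q t) \<longleftrightarrow> Q 0 \<or> Q 1" for Q :: "'a \<Rightarrow> bool" using F by metis
  have R: "(regular_planes :: ('a^2^2) set) = {mat2 0 1 0 0, mat2 0 1 1 0, mat2 0 1 1 1, mat2 0 0 1 0}"
    (is "_ = ?R")
  proof
    show "(regular_planes :: ('a^2^2) set) \<subseteq> ?R"
    proof
      fix P :: "'a^2^2" assume "P \<in> regular_planes"
      then obtain t where P: "P \<in> plane_reps" "invertible (mat t + P)"
        by (auto simp: regular_planes_def regular_def)
      from P(1) show "P \<in> ?R"
      proof (cases rule: repsE)
        case (1 c d)
        then show ?thesis using P(2) F[of c] F[of d] F[of t] by (auto simp: mat2_simps two)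
      next
        case (2 d)
        then show ?thesis using P(2) F[of d] F[of t] by (auto simp: mat2_simps two)
      next
        case 3
        then show ?thesis using P(2) F[of t] by (auto simp: mat2_simps two)
      qed
    qed
    show "?R \<subseteq> regular_planes"
      unfolding regular_planes_def regular_def ex by (auto simp: plane_reps_def mat2_simps two)
  qed
  have card: "card (regular_planes :: ('a^2^2) set) = 4"
    and ne: "(regular_planes :: ('a^2^2) set) \<noteq> {}" unfolding R by simp_all
  have "\<exists>P\<in>regular_planes. g \<in> torus P" if g: "g \<in> carrier PGL" for g :: "('a^2^2) set"
  proof (cases "g = \<one>\<^bsub>PGL\<^esub>")
    case True
    then show ?thesis using ne subgroup.one_closed[OF subgroup_torus] by auto
  next
    case False
    obtain A where A: "invertible A" "g = proj_class A" using g by (auto simp: carrier_PGL)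
    then have "regular A" using two by (simp add: regular_def)
    then show ?thesis using regular_plane_exists False A by metis
  qed
  from regular_tori_cover[OF c this] show ?thesis by (simp add: card)
qed

section \<open>The field with three elements\<close>

lemma field_three:
  assumes q: "CARD('a::{field, finite}) = 3"
  shows "(2::'a) = - 1" and "(1::'a) \<noteq> - 1" and "\<And>x :: 'a. x = 0 \<or> x = 1 \<or> x = - 1"
proof -
  have "CHAR('a) dvd 3" using CHAR_dvd_CARD[where 'a = 'a] q by simp
  then have "CHAR('a) = 3" using prime_nat_iff[of 3] CHAR_not_1[where 'a = 'a] by auto
  then have three: "(3::'a) = 0" by (metis of_nat_CHAR of_nat_numeral)
  show two: "(2::'a) = - 1"
    using three by (simp add: eq_neg_iff_add_eq_0)
  show one: "(1::'a) \<noteq> - 1"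
    using two by (metis add_cancel_right_right one_add_one zero_neq_one)
  have "{0, 1, - 1} = (UNIV :: 'a set)"
    by (rule card_seteq) (use q one in simp_all)
  then show "x = 0 \<or> x = 1 \<or> x = - 1" for x :: 'a by blast
qed

text \<open>
  Over the field with three elements \<open>rotation d\<close> and \<open>reflection d\<close> represent the involutions of
  determinant \<open>1\<close> and three of the six involutions of determinant \<open>-1\<close>; in the symmetric group
  on the four points of the projective line they are the double transpositions and three
  transpositions.  Each family is the orbit of its member at \<open>d = 0\<close> under conjugation by the
  transvections \<open>mat2 1 0 d 1\<close>, so the relations between the two do not depend on \<open>d\<close>.
\<close>

definition rotation :: "'a::field \<Rightarrow> 'a^2^2" where
  "rotation d = mat2 d 1 (- 1 - d\<^sup>2) (- d)"

definition reflection :: "'a::field \<Rightarrow> 'a^2^2" where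
  "reflection d = mat2 d 1 (1 - d\<^sup>2) (- d)"

lemma invertible_rotation: "invertible (rotation d)"
  by (simp add: rotation_def mat2_simps power2_eq_square)

lemma invertible_reflection: "invertible (reflection d)"
  by (simp add: reflection_def mat2_simps power2_eq_square)

lemma proj_class_reflection_neq_one: "proj_class (reflection d) \<noteq> \<one>\<^bsub>PGL\<^esub>"
  by (simp add: proj_class_eq_one_iff reflection_def mat2_simps)

lemma rotation_mult_reflection: "rotation d ** reflection d = mat2 1 0 (- 2 * d) (- 1)"
  by (simp add: rotation_def reflection_def mat2_simps algebra_simps power2_eq_square)

lemma rotation_reflection_commute:
  "proj_class (rotation d) \<otimes>\<^bsub>PGL\<^esub> proj_class (reflection d) = proj_class (reflection d) \<otimes>\<^bsub>PGL\<^esub> proj_class (rotation d)"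
  unfolding proj_class_commute_iff[OF invertible_rotation invertible_reflection]
  by (rule exI[of _ "- 1"]) (simp add: rotation_def reflection_def mat2_simps algebra_simps power2_eq_square)

text \<open>
  For \<open>d \<noteq> d'\<close> the scalar relating the two products can only be \<open>-1\<close>, and then the traces would have
  to vanish; but the trace is \<open>2 - (d - d')\<^sup>2 = 1\<close>.
\<close>

lemma reflection_not_commute:
  fixes d d' :: "'a::{field, finite}"
  assumes q: "CARD('a) = 3" and "d \<noteq> d'"
  shows "proj_class (reflection d) \<otimes>\<^bsub>PGL\<^esub> proj_class (reflection d') \<noteq> proj_class (reflection d') \<otimes>\<^bsub>PGL\<^esub> proj_class (reflection d)"
proof
  assume "proj_class (reflection d) \<otimes>\<^bsub>PGL\<^esub> proj_class (reflection d') = proj_class (reflection d') \<otimes>\<^bsub>PGL\<^esub> proj_class (reflection d)"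
  then obtain k where k: "reflection d ** reflection d' = mat k ** (reflection d' ** reflection d)"
    using proj_class_commute_iff[OF invertible_reflection invertible_reflection] by blast
  have 12: "d - d' = k * (d' - d)" and 11: "d * d' + (1 - d'\<^sup>2) = k * (d' * d + (1 - d\<^sup>2))"
    using k by (simp_all add: reflection_def mat2_simps)
  have "(k + 1) * (d' - d) = 0" using 12 by (simp add: algebra_simps)
  then have "k = - 1" using \<open>d \<noteq> d'\<close> by (simp add: eq_neg_iff_add_eq_0)
  then have "2 - (d - d')\<^sup>2 = 0" using 11 by (simp add: algebra_simps power2_eq_square)
  moreover have "(d - d')\<^sup>2 = 1"
    using field_three(3)[OF q, of "d - d'"] \<open>d \<noteq> d'\<close> by auto
  ultimately show False by simp
qed

text \<open>
  The Klein four-group containing the double transposition \<open>rotation d\<close> and a transposition that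
  commutes with it.
\<close>

definition klein :: "'a::field \<Rightarrow> ('a^2^2) set set" where
  "klein d = generate PGL {proj_class (rotation d), proj_class (reflection d)}"

lemma subgroup_klein: "subgroup (klein d) PGL"
  unfolding klein_def by (rule group.generate_is_subgroup[OF group_PGL])
    (simp add: proj_class_in_carrier invertible_rotation invertible_reflection)

lemma klein_c_nilpotent: "1 \<le> c \<Longrightarrow> c_nilpotent_in c PGL (klein d)"
  unfolding klein_def
  by (intro group.c_nilpotent_in_generate_commuting[OF group_PGL])
    (simp_all add: proj_class_in_carrier invertible_rotation invertible_reflection rotation_reflection_commute)

text \<open>
  These are the elements that no torus of a regular element contains, together with the
  rotations.  Up to a scalar factor the upper right entry of \<open>A\<close> is \<open>1\<close> or \<open>0\<close>.  In
  the first case the determinant \<open>1\<close> or \<open>-1\<close> makes the matrix a rotation or a reflection, in the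
  second case it is the product of a rotation and a reflection.
\<close>

lemma traceless_in_klein:
  fixes A :: "'a::{field, finite}^2^2"
  assumes q: "CARD('a) = 3" and A: "invertible A" "trace A = 0"
  shows "\<exists>d. proj_class A \<in> klein d"
proof -
  obtain a b c e where "A = mat2 a b c e" by (rule mat2_exhaust)
  moreover from this have "e = - a" using A(2) by (simp add: mat2_simps eq_neg_iff_add_eq_0 add.commute)
  ultimately have A_eq: "A = mat2 a b c (- a)" by simp
  have det: "a * a + b * c \<noteq> 0" using A(1) by (simp add: A_eq mat2_simps) (simp add: algebra_simps add_eq_0_iff)
  note gen = generate.incl[of _ "{proj_class (rotation _), proj_class (reflection _)}" PGL]
  show ?thesis
  proof (cases "b = 0")
    case True
    then have "a \<noteq> 0" using det by auto
    then have "A = mat a ** (rotation (c / a) ** reflection (c / a))"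
      using True by (simp add: A_eq rotation_mult_reflection mat2_simps field_three(1)[OF q])
    then have "proj_class A = proj_class (rotation (c / a)) \<otimes>\<^bsub>PGL\<^esub> proj_class (reflection (c / a))"
      using \<open>a \<noteq> 0\<close> by (auto simp: proj_class_mult invertible_rotation invertible_reflection proj_class_eq_iff)
    then have "proj_class A \<in> klein (c / a)"
      unfolding klein_def by (simp add: generate.eng generate.incl)
    then show ?thesis ..
  next
    case False
    let ?d = "a / b"
    have "?d\<^sup>2 + c / b = (a * a + b * c) / (b * b)"
      using False by (simp add: field_simps power2_eq_square)
    then have "?d\<^sup>2 + c / b \<noteq> 0" using det False by simp
    then have "?d\<^sup>2 + c / b = 1 \<or> ?d\<^sup>2 + c / b = - 1" using field_three(3)[OF q] by blast
    then have "c / b = 1 - ?d\<^sup>2 \<or> c / b = - 1 - ?d\<^sup>2" by (auto simp: eq_diff_eq add.commute)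
    then have "A = mat b ** reflection ?d \<or> A = mat b ** rotation ?d"
    proof (elim disjE)
      assume e: "c / b = 1 - ?d\<^sup>2"
      have "A = mat b ** reflection ?d" unfolding reflection_def e[symmetric] using False
        by (simp add: A_eq mat2_simps)
      then show ?thesis ..
    next
      assume e: "c / b = - 1 - ?d\<^sup>2"
      have "A = mat b ** rotation ?d" unfolding rotation_def e[symmetric] using False
        by (simp add: A_eq mat2_simps)
      then show ?thesis ..
    qed
    then have "proj_class A = proj_class (reflection ?d) \<or> proj_class A = proj_class (rotation ?d)" using False proj_class_eq_iff by blast
    then have "proj_class A \<in> klein ?d" unfolding klein_def by (auto intro: generate.incl)
    then show ?thesis ..
  qed
qed

text \<open>
  The representatives of the planes through \<open>rotation d\<close> and \<open>reflection d\<close>.  In characteristic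
  three \<open>-d - d = d\<close>, which is the lower right entry after subtracting \<open>mat d\<close>.
\<close>

definition rotation_plane :: "'a::field \<Rightarrow> 'a^2^2" where
  "rotation_plane d = mat2 0 1 (- 1 - d\<^sup>2) d"

definition reflection_plane :: "'a::field \<Rightarrow> 'a^2^2" where
  "reflection_plane d = mat2 0 1 (1 - d\<^sup>2) d"

lemma rotation_in_torus:
  fixes d :: "'a::{field, finite}"
  assumes q: "CARD('a) = 3"
  shows "proj_class (rotation d) \<in> torus (rotation_plane d)"
proof -
  have "- d = d + d" using field_three(1)[OF q] by (metis mult_2 mult_minus1)
  then have "rotation d = mat d + mat 1 ** rotation_plane d"
    by (simp add: rotation_def rotation_plane_def mat2_simps)
  moreover have "rotation_plane d \<in> plane_reps" by (auto simp: rotation_plane_def plane_reps_def)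
  ultimately show ?thesis
    using invertible_rotation[of d] by (auto simp: torus_reps simp del: matrix_mul_lid)
qed

lemma reflection_in_torus:
  fixes d :: "'a::{field, finite}"
  assumes q: "CARD('a) = 3"
  shows "proj_class (reflection d) \<in> torus (reflection_plane d)"
proof -
  have "- d = d + d" using field_three(1)[OF q] by (metis mult_2 mult_minus1)
  then have "reflection d = mat d + mat 1 ** reflection_plane d"
    by (simp add: reflection_def reflection_plane_def mat2_simps)
  moreover have "reflection_plane d \<in> plane_reps" by (auto simp: reflection_plane_def plane_reps_def)
  ultimately show ?thesis
    using invertible_reflection[of d] by (auto simp: torus_reps simp del: matrix_mul_lid)
qed

text \<open>
  The plane of \<open>mat2 0 1 c d\<close> is governed by the discriminant \<open>d\<^sup>2 + 4 c = d\<^sup>2 + c\<close>.  It is \<open>0\<close> for the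
  first family, the transvection groups, to which also \<open>mat2 0 0 1 0\<close> belongs; it is the nonsquare
  \<open>-1\<close> for the rotation planes, the nonsplit tori; and the split tori have order two, so that their
  only nontrivial element is an involution and not regular.
\<close>

lemma regular_planes_three:
  assumes q: "CARD('a::{field, finite}) = 3"
  shows "(regular_planes :: ('a^2^2) set) =
    range (\<lambda>d. mat2 0 1 (- d\<^sup>2) d) \<union> range rotation_plane \<union> {mat2 0 0 1 0}"
proof -
  note two = field_three(1)[OF q]
  note F = field_three(3)[OF q]
  have ex: "(\<exists>t. Q t) \<longleftrightarrow> Q 0 \<or> Q 1 \<or> Q (- 1)" for Q :: "'a \<Rightarrow> bool" using F by metis
  have neq: "(1::'a) \<noteq> - 1" "(- 1::'a) \<noteq> 1" using field_three(2)[OF q] by auto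
  have in_reps: "mat2 0 1 c d \<in> plane_reps" "mat2 0 0 1 d \<in> plane_reps" for c d :: 'a
    by (auto simp: plane_reps_def)
  have first: "mat2 0 1 c d \<in> regular_planes \<longleftrightarrow> c = - d\<^sup>2 \<or> c = - 1 - d\<^sup>2" for c d :: 'a
    unfolding regular_planes_def regular_def ex
    using F[of c] F[of d] neq by (elim disjE) (simp_all add: in_reps mat2_simps two)
  have second: "mat2 0 0 1 d \<in> regular_planes \<longleftrightarrow> d = 0" for d :: 'a
    unfolding regular_planes_def regular_def ex
    using F[of d] neq by (elim disjE) (simp_all add: in_reps mat2_simps two)
  have third: "(mat2 0 0 0 1 :: 'a^2^2) \<notin> regular_planes"
    unfolding regular_planes_def regular_def ex using neq by (simp add: mat2_simps two)
  show ?thesis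
  proof
    show "regular_planes \<subseteq> range (\<lambda>d. mat2 0 1 (- d\<^sup>2) d) \<union> range rotation_plane \<union> {mat2 0 0 1 (0::'a)}"
    proof
      fix P :: "'a^2^2" assume PR: "P \<in> regular_planes"
      then have "P \<in> plane_reps" by (simp add: regular_planes_def)
      then show "P \<in> range (\<lambda>d. mat2 0 1 (- d\<^sup>2) d) \<union> range rotation_plane \<union> {mat2 0 0 1 0}"
        by (cases rule: repsE) (use PR first second third in \<open>auto simp: rotation_plane_def\<close>)
    qed
    show "range (\<lambda>d. mat2 0 1 (- d\<^sup>2) d) \<union> range rotation_plane \<union> {mat2 0 0 1 (0::'a)} \<subseteq> regular_planes"
      using first second by (auto simp: rotation_plane_def)
  qed
qed

lemma card_regular_planes_three:
  assumes q: "CARD('a::{field, finite}) = 3"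
  shows "card (regular_planes :: ('a^2^2) set) = 7"
    and "card (regular_planes \<union> range reflection_plane :: ('a^2^2) set) = 10"
    and "(range reflection_plane :: ('a^2^2) set) \<inter> regular_planes = {}"
proof -
  let ?U = "range (\<lambda>d. mat2 0 1 (- d\<^sup>2) d) :: ('a^2^2) set"
  let ?R = "range rotation_plane :: ('a^2^2) set" and ?S = "range reflection_plane :: ('a^2^2) set"
  have neq: "(1::'a) \<noteq> - 1" "(- 1::'a) \<noteq> 1" using field_three(2)[OF q] by auto
  have U: "card ?U = 3" by (subst card_image) (auto simp: inj_on_def q)
  have R: "card ?R = 3" by (subst card_image) (auto simp: inj_on_def q rotation_plane_def)
  have S: "card ?S = 3" by (subst card_image) (auto simp: inj_on_def q reflection_plane_def)
  have "?U \<inter> ?R = {}" "(?U \<union> ?R) \<inter> {mat2 0 0 1 0} = {}" by (auto simp: rotation_plane_def)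
  then have UR: "card ((?U \<union> ?R) \<union> {mat2 0 0 1 0}) = 7"
    by (simp only: card_Un_disjoint finite U R) simp
  show c7: "card (regular_planes :: ('a^2^2) set) = 7"
    unfolding regular_planes_three[OF q] by (rule UR)
  show disj: "?S \<inter> regular_planes = {}"
    unfolding regular_planes_three[OF q] using neq by (auto simp: rotation_plane_def reflection_plane_def)
  show "card (regular_planes \<union> ?S) = 10"
    using disj by (subst card_Un_disjoint) (simp_all add: c7 S Int_commute)
qed

text \<open>
  The centralizer of a rotation is a dihedral group of order eight.  A matrix \<open>B\<close> that anticommutes
  with the rotation has trace zero, so \<open>B\<^sup>2\<close> is scalar.  A matrix that commutes with it is
  \<open>z + b M\<close> where \<open>M\<^sup>2 = -1\<close>, and its square \<open>z\<^sup>2 - b\<^sup>2 + 2 z b M\<close> is a multiple of \<open>1\<close> if \<open>z b = 0\<close>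
  and of \<open>M\<close> otherwise, since all nonzero squares are \<open>1\<close>.
\<close>

lemma centralizer_rotation_square:
  fixes d :: "'a::{field, finite}"
  assumes q: "CARD('a) = 3" and g: "g \<in> group.centralizer PGL (proj_class (rotation d))"
  shows "g \<otimes>\<^bsub>PGL\<^esub> g = \<one>\<^bsub>PGL\<^esub> \<or> g \<otimes>\<^bsub>PGL\<^esub> g = proj_class (rotation d)"
proof -
  interpret group "PGL :: ('a^2^2) set monoid" by (rule group_PGL)
  obtain B where B: "invertible B" "g = proj_class B" using g by (auto simp: centralizer_def carrier_PGL)
  have gg: "g \<otimes>\<^bsub>PGL\<^esub> g = proj_class (B ** B)" using B by (simp add: proj_class_mult)
  have iBB: "invertible (B ** B)" using B(1) by (simp add: invertible_mult)
  obtain k where k: "rotation d ** B = mat k ** (B ** rotation d)"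
    using g B proj_class_commute_iff[OF invertible_rotation B(1)] by (auto simp: centralizer_def)
  have "det (rotation d ** B) = k\<^sup>2 * det (B ** rotation d)" unfolding k by (rule det_mat_mult)
  then have "k\<^sup>2 = 1"
    using B(1) invertible_rotation[of d] by (simp add: det_mul invertible_det_nz)
  then have k1: "k = 1 \<or> k = - 1" by (simp add: power2_eq_1_iff)
  obtain a b c e where B_eq: "B = mat2 a b c e" by (rule mat2_exhaust)
  have 12: "d * b + e = k * (a - b * d)" and 11: "d * a + c = k * (a * d + b * (- 1 - d\<^sup>2))"
    using k by (simp_all add: B_eq rotation_def mat2_simps)
  from k1 show ?thesis
  proof
    assume "k = - 1"
    then have "a + e = 0" using 12 by (simp add: algebra_simps)
    then have "e = - a" by (metis add_eq_0_iff)
    then have BB: "B ** B = mat (a * a + b * c)" by (simp add: B_eq mat2_simps algebra_simps)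
    then have "a * a + b * c \<noteq> 0" using iBB by (auto simp: mat2_simps)
    then show ?thesis unfolding gg BB using proj_class_eq_one_iff by blast
  next
    assume "k = 1"
    define z where "z = a - b * d"
    have e: "e = z - b * d" and a: "a = z + b * d"
      using 12 \<open>k = 1\<close> by (simp_all add: z_def algebra_simps)
    have c: "c = b * (- 1 - d\<^sup>2)"
      using 11 unfolding \<open>k = 1\<close> mult.commute[of d a] by simp
    have BB: "B ** B = mat (z * z - b * b) + mat (2 * z * b) ** rotation d"
      by (simp add: B_eq e c a rotation_def mat2_simps algebra_simps power2_eq_square)
    show ?thesis
    proof (cases "z * b = 0")
      case True
      then have "B ** B = mat (z * z - b * b)" unfolding BB by (auto simp: rotation_def mat2_simps)
      moreover from this have "z * z - b * b \<noteq> 0" using iBB by (auto simp: mat2_simps)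
      ultimately show ?thesis unfolding gg using proj_class_eq_one_iff by metis
    next
      case False
      then have "z * z = 1" "b * b = 1"
        using field_three(3)[OF q, of z] field_three(3)[OF q, of b] by auto
      then have "B ** B = mat (2 * z * b) ** rotation d" unfolding BB by (simp add: mat2_simps rotation_def)
      moreover have "2 * z * b \<noteq> 0" using False by (simp add: field_three(1)[OF q])
      ultimately show ?thesis unfolding gg using proj_class_eq_iff by metis
    qed
  qed
qed

lemma centralizer_rotation_c_nilpotent:
  fixes d :: "'a::{field, finite}"
  assumes q: "CARD('a) = 3" and c: "1 < c"
  shows "c_nilpotent_in c PGL (group.centralizer PGL (proj_class (rotation d)))"
proof -
  interpret group "PGL :: ('a^2^2) set monoid" by (rule group_PGL)
  show ?thesis
  proof (rule class_two_if_squares_central[OF subgroup_centralizer[OF proj_class_in_carrier[OF invertible_rotation]] c])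
    fix g h assume g: "g \<in> centralizer (proj_class (rotation d))" and h: "h \<in> centralizer (proj_class (rotation d))"
    then show "g \<otimes>\<^bsub>PGL\<^esub> g \<otimes>\<^bsub>PGL\<^esub> h = h \<otimes>\<^bsub>PGL\<^esub> (g \<otimes>\<^bsub>PGL\<^esub> g)"
      using centralizer_rotation_square[OF q g] by (auto simp: centralizer_def)
  qed
qed

lemma PGL_three_element_cases:
  fixes g :: "('a::{field, finite}^2^2) set"
  assumes q: "CARD('a) = 3" and g: "g \<in> carrier PGL"
  obtains P where "P \<in> regular_planes" "g \<in> torus P" | d where "g \<in> klein d"
proof (cases "g = \<one>\<^bsub>PGL\<^esub>")
  case True
  then show ?thesis using that(2)[of 0] subgroup.one_closed[OF subgroup_klein] by metis
next
  case False
  obtain A where A: "invertible A" "g = proj_class A" using g by (auto simp: carrier_PGL)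
  show ?thesis
  proof (cases "trace A = 0")
    case True
    then show ?thesis using traceless_in_klein[OF q A(1)] A(2) that(2) by blast
  next
    case nz: False
    then have "regular A" using A(1) by (simp add: regular_def)
    then show ?thesis using regular_plane_exists[of A] False A(2) that(1) by metis
  qed
qed

text \<open>
  The three nonsplit tori are replaced by the centralizers of the rotations, which are
  the Sylow two-subgroups; each contains one of the Klein groups and so they cover the nonregular
  elements.  The distinguished elements remain the regular ones.
\<close>

lemma PGL_three_nonabelian:
  fixes c :: enat
  assumes q: "CARD('a::{field, finite}) = 3" and c: "1 < c"
  shows "(\<exists>N. c_nilpotent_cover c PGL N \<and> two_minimal c (PGL :: ('a^2^2) set monoid) N) \<and>
    omega c (PGL :: ('a^2^2) set monoid) = 7"
proof -
  interpret group "PGL :: ('a^2^2) set monoid" by (rule group_PGL)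
  have c1: "1 \<le> c" using c by simp
  obtain e :: "'a^2^2 \<Rightarrow> ('a^2^2) set" where e:
    "\<And>P. P \<in> regular_planes \<Longrightarrow> e P \<in> torus P"
    "\<And>P. P \<in> regular_planes \<Longrightarrow> e P \<noteq> \<one>\<^bsub>PGL\<^esub>"
    "\<And>P. P \<in> regular_planes \<Longrightarrow> centralizer (e P) = torus P"
    using regular_elements[where ?'a = 'a] by blast
  have plane_reps: "P \<in> plane_reps" if "P \<in> regular_planes" for P :: "'a^2^2"
    using that by (simp add: regular_planes_def)
  define Y :: "'a^2^2 \<Rightarrow> ('a^2^2) set set" where
    "Y P = (if P \<in> range rotation_plane then centralizer (proj_class (rotation (P $ 2 $ 2))) else torus P)" for P
  have Y_rotation: "Y (rotation_plane d) = centralizer (proj_class (rotation d))" for d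
    by (simp add: Y_def) (simp add: rotation_plane_def)
  have rotG: "proj_class (rotation d) \<in> carrier PGL" for d :: 'a by (simp add: proj_class_in_carrier invertible_rotation)
  have rotation_reg: "rotation_plane d \<in> regular_planes" for d :: 'a
    unfolding regular_planes_three[OF q] by blast
  have torus_Y: "torus P \<subseteq> Y P" if P: "P \<in> plane_reps" for P
  proof (cases "P \<in> range rotation_plane")
    case True
    then obtain d where d: "P = rotation_plane d" by blast
    show ?thesis unfolding d Y_rotation
      using torus_abelian[OF P[unfolded d] rotation_in_torus[OF q]] subgroup.subset[OF subgroup_torus]
      by (auto simp: centralizer_def)
  qed (simp add: Y_def)
  have klein_Y: "klein d \<subseteq> Y (rotation_plane d)" for d
    unfolding Y_rotation klein_def
    by (rule generate_subgroup_incl[OF _ subgroup_centralizer[OF rotG]])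
      (simp add: centralizer_def proj_class_in_carrier invertible_rotation invertible_reflection rotation_reflection_commute)
  have "(\<exists>N. c_nilpotent_cover c PGL N \<and> two_minimal c (PGL :: ('a^2^2) set monoid) N) \<and>
    omega c (PGL :: ('a^2^2) set monoid) = card (regular_planes :: ('a^2^2) set)"
  proof (rule two_minimal_cover_omega[of regular_planes Y c e])
    fix P :: "'a^2^2" assume P: "P \<in> regular_planes"
    show "subgroup (Y P) PGL"
      by (simp add: Y_def subgroup_torus subgroup_centralizer rotG)
    show "c_nilpotent_in c PGL (Y P)"
      using P by (simp add: Y_def torus_c_nilpotent[OF plane_reps c1] centralizer_rotation_c_nilpotent[OF q c])
    show "e P \<in> Y P" using e(1)[OF P] torus_Y[OF plane_reps[OF P]] by blast
  next
    fix g :: "('a^2^2) set" assume "g \<in> carrier PGL"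
    then show "\<exists>P\<in>regular_planes. g \<in> Y P"
      by (rule PGL_three_element_cases[OF q]) (use torus_Y plane_reps klein_Y rotation_reg in blast)+
  next
    fix P Q :: "'a^2^2"
    assume "P \<in> regular_planes" "Q \<in> regular_planes" "P \<noteq> Q"
    then show "\<not> c_nilpotent_in c PGL (generate PGL {e P, e Q})"
      using e plane_reps by (intro regular_elements_not_nilpotent[of P Q]) auto
  qed simp
  then show ?thesis by (simp add: card_regular_planes_three(1)[OF q])
qed

text \<open>
  Abelian subgroups are too small to absorb the nonregular elements, so three Klein groups are
  added, indexed by the planes of the reflections, which are their distinguished elements.
  A reflection lies in its own split torus and therefore in no centralizer of a regular element.
\<close>

lemma PGL_three_abelian:
  assumes q: "CARD('a::{field, finite}) = 3"
  shows "(\<exists>N. c_nilpotent_cover 1 PGL N \<and> two_minimal 1 (PGL :: ('a^2^2) set monoid) N) \<and>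
    omega 1 (PGL :: ('a^2^2) set monoid) = 10"
proof -
  interpret group "PGL :: ('a^2^2) set monoid" by (rule group_PGL)
  obtain e :: "'a^2^2 \<Rightarrow> ('a^2^2) set" where e:
    "\<And>P. P \<in> regular_planes \<Longrightarrow> e P \<in> torus P"
    "\<And>P. P \<in> regular_planes \<Longrightarrow> e P \<noteq> \<one>\<^bsub>PGL\<^esub>"
    "\<And>P. P \<in> regular_planes \<Longrightarrow> centralizer (e P) = torus P"
    using regular_elements[where ?'a = 'a] by blast
  note disj = card_regular_planes_three(3)[OF q]
  have reflection_reps: "reflection_plane d \<in> plane_reps" for d :: 'a by (auto simp: reflection_plane_def plane_reps_def)
  define I where "I = (regular_planes \<union> range reflection_plane :: ('a^2^2) set)"
  have plane_reps: "P \<in> plane_reps" if "P \<in> I" for P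
    using that reflection_reps by (auto simp: I_def regular_planes_def)
  define Y :: "'a^2^2 \<Rightarrow> ('a^2^2) set set" where
    "Y P = (if P \<in> regular_planes then torus P else klein (P $ 2 $ 2))" for P
  define f :: "'a^2^2 \<Rightarrow> ('a^2^2) set" where
    "f P = (if P \<in> regular_planes then e P else proj_class (reflection (P $ 2 $ 2)))" for P
  have nonreg: "reflection_plane d \<notin> regular_planes" for d :: 'a using disj by blast
  have Y_reflection: "Y (reflection_plane d) = klein d" for d
    using nonreg by (simp add: Y_def) (simp add: reflection_plane_def)
  have f_reflection: "f (reflection_plane d) = proj_class (reflection d)" for d
    using nonreg by (simp add: f_def) (simp add: reflection_plane_def)
  have f_torus: "f P \<in> torus P" "f P \<noteq> \<one>\<^bsub>PGL\<^esub>" if P: "P \<in> I" for P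
  proof -
    consider "P \<in> regular_planes" | d where "P = reflection_plane d" using P by (auto simp: I_def)
    then have "f P \<in> torus P \<and> f P \<noteq> \<one>\<^bsub>PGL\<^esub>"
    proof cases
      case 1
      then show ?thesis using e by (simp add: f_def)
    next
      case 2
      then show ?thesis using reflection_in_torus[OF q] proj_class_reflection_neq_one by (simp add: f_reflection)
    qed
    then show "f P \<in> torus P" "f P \<noteq> \<one>\<^bsub>PGL\<^esub>" by simp_all
  qed
  have fG: "f P \<in> carrier PGL" if "P \<in> I" for P
    using f_torus(1)[OF that] subgroup.subset[OF subgroup_torus] by blast
  have not_commute: "f P \<otimes>\<^bsub>PGL\<^esub> f Q \<noteq> f Q \<otimes>\<^bsub>PGL\<^esub> f P"
    if PQ: "P \<in> I" "Q \<in> I" "P \<noteq> Q" for P Q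
  proof
    assume comm: "f P \<otimes>\<^bsub>PGL\<^esub> f Q = f Q \<otimes>\<^bsub>PGL\<^esub> f P"
    have key: False if R: "R \<in> regular_planes" "S \<in> I" "R \<noteq> S"
      and RS: "f R \<otimes>\<^bsub>PGL\<^esub> f S = f S \<otimes>\<^bsub>PGL\<^esub> f R" for R S
    proof -
      have RI: "R \<in> I" using R by (simp add: I_def)
      have "f S \<in> centralizer (f R)" using RS fG[OF R(2)] by (simp add: centralizer_def)
      then have "f S \<in> torus R" using e(3)[OF R(1)] R(1) by (simp add: f_def)
      then show False
        using torus_inter[OF plane_reps[OF RI] plane_reps[OF R(2)] R(3)] f_torus[OF R(2)] by blast
    qed
    show False
    proof (cases "P \<in> regular_planes \<or> Q \<in> regular_planes")
      case True
      then show ?thesis using key[of P Q] key[of Q P] PQ comm by auto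
    next
      case False
      then obtain d d' where d: "P = reflection_plane d" "Q = reflection_plane d'" using PQ by (auto simp: I_def)
      then have "d \<noteq> d'" using PQ by auto
      then show ?thesis using reflection_not_commute[OF q] comm by (simp add: d f_reflection)
    qed
  qed
  have "(\<exists>N. c_nilpotent_cover 1 PGL N \<and> two_minimal 1 (PGL :: ('a^2^2) set monoid) N) \<and>
    omega 1 (PGL :: ('a^2^2) set monoid) = card I"
  proof (rule two_minimal_cover_omega[of I Y 1 f])
    show "finite I" by simp
  next
    fix P :: "'a^2^2" assume P: "P \<in> I"
    show "subgroup (Y P) PGL" by (simp add: Y_def subgroup_torus subgroup_klein)
    show "c_nilpotent_in 1 PGL (Y P)"
      using P by (simp add: Y_def torus_c_nilpotent[OF plane_reps] klein_c_nilpotent)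
    have "proj_class (reflection d) \<in> klein d" for d :: 'a unfolding klein_def by (auto intro: generate.incl)
    then show "f P \<in> Y P" using e(1) by (simp add: f_def Y_def)
  next
    fix g :: "('a^2^2) set" assume "g \<in> carrier PGL"
    then show "\<exists>P\<in>I. g \<in> Y P"
    proof (rule PGL_three_element_cases[OF q])
      fix P assume "P \<in> regular_planes" "g \<in> torus P"
      then show ?thesis by (intro bexI[of _ P]) (auto simp: Y_def I_def)
    next
      fix d assume "g \<in> klein d"
      then show ?thesis by (intro bexI[of _ "reflection_plane d"]) (auto simp: Y_reflection I_def)
    qed
  next
    fix P Q :: "'a^2^2"
    assume PQ: "P \<in> I" "Q \<in> I" "P \<noteq> Q"
    have "subgroup (generate PGL {f P, f Q}) PGL"
      using fG PQ by (intro generate_is_subgroup) auto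
    then show "\<not> c_nilpotent_in 1 PGL (generate PGL {f P, f Q})"
      using one_nilpotent_imp_commute not_commute[OF PQ] generate.incl[of _ "{f P, f Q}" PGL] by blast
  qed
  then show ?thesis by (simp add: I_def card_regular_planes_three(2)[OF q])
qed

section \<open>Non-nilpotent subsets of the projective general linear group\<close>

theorem theorem5p2:
  fixes q :: nat
    and c :: enat
    and G :: "('a::{field, finite}^2^2) set monoid"
  assumes "primepow q"
    and "CARD('a) = q"
    and "G = PGL"
    and "c \<ge> 1"
  shows "(\<exists>N. c_nilpotent_cover c G N \<and> two_minimal c G N) \<and>
    (q = 2 \<longrightarrow> omega c G = 4) \<and>
    (c > 1 \<and> q = 3 \<longrightarrow> omega c G = 7) \<and>
    (c = 1 \<and> q = 3 \<longrightarrow> omega c G = 10) \<and>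
    (q \<ge> 4 \<longrightarrow> omega c G = q\<^sup>2 + q + 1)"
proof -
  have "1 < q" using primepow_gt_Suc_0[OF assms(1)] by simp
  then consider "q = 2" | "q = 3" "c = 1" | "q = 3" "c > 1" | "q \<ge> 4"
    using assms(4) by fastforce
  then show ?thesis
  proof cases
    case 1
    then show ?thesis using PGL_two[where ?'a = 'a, OF assms(4)] assms(2,3) by simp
  next
    case 2
    then show ?thesis using PGL_three_abelian[where ?'a = 'a] assms(2,3) by simp
  next
    case 3
    then show ?thesis using PGL_three_nonabelian[where ?'a = 'a and c = c] assms(2,3) by auto
  next
    case 4
    then show ?thesis using PGL_large[where ?'a = 'a, OF assms(4)] assms(2,3) by simp
  qed
qed

end
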